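(* Let $F(x)=\psi(x)+f(x)$ with $f(x)=\frac1n\sum_{i=1}^n f_i(x)$ on $\mathbb{R}^d$, where each $f_i$ is convex with $L_i$-Lipschitz gradient, $f$ has $L$-Lipschitz gradient, $\psi$ is proper, closed and convex, and $F$ is $\mu$-strongly convex with minimizer $x^*$. Let $P=\{p_1,\dots,p_n\}$ be a probability distribution on $\{1,\dots,n\}$, and let $L_Q=\max_i \frac{L_i}{p_i n}$ and $\kappa_Q=L_Q/\mu$. Run the Prox-SVRG algorithm with sampling distribution $P$, expected epoch length $m=n+121\kappa_Q$ and step size $\eta=\kappa_Q^{1/2}m^{-1/2}/(2L_Q)$. Then Prox-SVRG has convergence rate $\rho\le\sqrt{\frac{100}{121+(n/\kappa_Q)}}$, i.e. $$\mathbb{E}[F(x^k)-F(x^* )]\le\rho^k\,[F(x^0)-F(x^* )]\quad\text{for all }k\ge 0,$$ and hence it needs $$K(\epsilon)=\mathcal{O}\left(\left(\frac{n}{1+(\ln(n/\kappa_Q))_+}+\kappa_Q\right)\ln\frac1\epsilon+n+\kappa_Q\right)$$ iterations in expectation to obtain a point $x^{K(\epsilon)}$ such that $\mathbb{E}[F(x^{K(\epsilon)})-F(x^* )]<\epsilon$.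
   Context: For $a\in\mathbb{R}$, $(a)_+=\max\{a,0\}$. $F$ is $\mu$-strongly convex if $F(y)\ge F(x)+\langle g,y-x\rangle+\frac{\mu}{2}\|y-x\|^2$ for all $x,y\in\mathbb{R}^d$ and all $g\in\partial F(x)$. Prox-SVRG$(F,x^0,\eta,m)$ with sampling distribution $P$: for each epoch $k=0,1,2,\dots$, draw a geometric random variable $M^k$ with success probability $1/m$ (so $\mathbb{E}M^k=m$), set $w_0=x^k$ and compute $g=\nabla f(x^k)$. For $t=0,\dots,M^k$: draw $i_t\in\{1,\dots,n\}$ independently with $\mathbb{P}[i_t=i]=p_i$; set $\tilde\nabla_t=g+\big(\nabla f_{i_t}(w_t)-\nabla f_{i_t}(w_0)\big)/(np_{i_t})$; set $w_{t+1}=\arg\min_{y\in\mathbb{R}^d}\{\psi(y)+\frac{1}{2\eta}\|y-w_t\|^2+\langle\tilde\nabla_t,y\rangle\}$. Then set $x^{k+1}=w_{M^k+1}$. In the rate inequality, $x^k$ is the iterate after $k$ epochs. The complexity $K(\epsilon)$ (``iterations'') counts the expected number of component gradient evaluations $\nabla f_i$, a full gradient $\nabla f$ costing $n$ of them; $x^{K(\epsilon)}$ denotes the epoch iterate obtained with that budget. The initial suboptimality $F(x^0)-F(x^* )$ is treated as a fixed constant in the $\mathcal{O}(\cdot)$ notation, and $\epsilon$ is small. *)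

theory Defs
  imports "HOL-Probability.Probability"
begin

text \<open>
  The space of dimension d is represented by a finite-dimensional subspace E of a real inner
  product space, not by a type of class euclidean_space. The constants in the complexity bound have
  to be chosen before d, and a dimension that is encoded in a type cannot be quantified inside a
  formula. E = UNIV in real ^ 'd is a special case; an infinite-dimensional ambient space has
  subspaces E of every dimension. Functions matter only on E, and derivatives are taken within E.
\<close>

definition gradient_on :: "'a::real_inner set \<Rightarrow> ('a \<Rightarrow> real) \<Rightarrow> 'a \<Rightarrow> 'a" where
  "gradient_on E f x = (THE g. g \<in> E \<and> (f has_derivative (\<lambda>h. g \<bullet> h)) (at x within E))"

definition epigraph_on :: "'a set \<Rightarrow> ('a \<Rightarrow> ereal) \<Rightarrow> ('a \<times> real) set" where
  "epigraph_on E \<psi> = {(x, t). x \<in> E \<and> \<psi> x \<le> ereal t}"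

definition proper_closed_convex_on :: "'a::real_inner set \<Rightarrow> ('a \<Rightarrow> ereal) \<Rightarrow> bool" where
  "proper_closed_convex_on E \<psi> \<longleftrightarrow>
     (\<forall>x\<in>E. \<psi> x \<noteq> -\<infinity>) \<and> (\<exists>x\<in>E. \<psi> x \<noteq> \<infinity>) \<and>
     closed (epigraph_on E \<psi>) \<and> convex (epigraph_on E \<psi>)"

definition subdifferential_on :: "'a::real_inner set \<Rightarrow> ('a \<Rightarrow> ereal) \<Rightarrow> 'a \<Rightarrow> 'a set" where
  "subdifferential_on E F x = {g \<in> E. \<forall>y\<in>E. F y \<ge> F x + ereal (g \<bullet> (y - x))}"

definition strongly_convex_on :: "'a::real_inner set \<Rightarrow> real \<Rightarrow> ('a \<Rightarrow> ereal) \<Rightarrow> bool" where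
  "strongly_convex_on E \<mu> F \<longleftrightarrow>
     (\<forall>x\<in>E. \<forall>y\<in>E. \<forall>g\<in>subdifferential_on E F x.
        F y \<ge> F x + ereal (g \<bullet> (y - x) + \<mu> / 2 * (norm (y - x))\<^sup>2))"

definition favg :: "nat \<Rightarrow> (nat \<Rightarrow> 'a \<Rightarrow> real) \<Rightarrow> 'a \<Rightarrow> real" where
  "favg n f x = (1 / real n) * (\<Sum>i=1..n. f i x)"

definition objective :: "nat \<Rightarrow> (nat \<Rightarrow> 'a \<Rightarrow> real) \<Rightarrow> ('a \<Rightarrow> ereal) \<Rightarrow> 'a \<Rightarrow> ereal" where
  "objective n f \<psi> x = \<psi> x + ereal (favg n f x)"

definition L_Q :: "nat \<Rightarrow> (nat \<Rightarrow> real) \<Rightarrow> nat pmf \<Rightarrow> real" where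
  "L_Q n L P = (MAX i\<in>{1..n}. L i / (pmf P i * real n))"

definition kappa_Q :: "nat \<Rightarrow> (nat \<Rightarrow> real) \<Rightarrow> nat pmf \<Rightarrow> real \<Rightarrow> real" where
  "kappa_Q n L P \<mu> = L_Q n L P / \<mu>"

text \<open>
  Every sampling probability has to be positive, since the algorithm and L_Q divide by it.
  Likewise L_Q > 0 is needed for the step size, which has L_Q in its denominator.
\<close>

locale prox_finite_sum =
  fixes E :: "'a::real_inner set"
    and n :: nat
    and f :: "nat \<Rightarrow> 'a \<Rightarrow> real"
    and \<psi> :: "'a \<Rightarrow> ereal"
    and L :: "nat \<Rightarrow> real"
    and Lf \<mu> :: real
    and xstar :: 'a
    and P :: "nat pmf"
  assumes n_pos: "1 \<le> n"
    and finite_dim: "\<exists>B. finite B \<and> span B = E"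
    and f_convex: "\<And>i. i \<in> {1..n} \<Longrightarrow> convex_on E (f i)"
    and f_differentiable: "\<And>i x. i \<in> {1..n} \<Longrightarrow> x \<in> E \<Longrightarrow>
          \<exists>g\<in>E. (f i has_derivative (\<lambda>h. g \<bullet> h)) (at x within E)"
    and f_smooth: "\<And>i. i \<in> {1..n} \<Longrightarrow> (L i)-lipschitz_on E (gradient_on E (f i))"
    and favg_smooth: "Lf-lipschitz_on E (gradient_on E (favg n f))"
    and psi: "proper_closed_convex_on E \<psi>"
    and mu_pos: "0 < \<mu>"
    and F_strongly_convex: "strongly_convex_on E \<mu> (objective n f \<psi>)"
    and xstar_in: "xstar \<in> E"
    and xstar_minimizer: "\<And>y. y \<in> E \<Longrightarrow> objective n f \<psi> xstar \<le> objective n f \<psi> y"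
    and P_support: "set_pmf P = {1..n}"
    and L_Q_pos: "0 < L_Q n L P"

definition prox_step :: "'a::real_inner set \<Rightarrow> ('a \<Rightarrow> ereal) \<Rightarrow> real \<Rightarrow> 'a \<Rightarrow> 'a \<Rightarrow> 'a" where
  "prox_step E \<psi> \<eta> v w =
     arg_min_on (\<lambda>y. \<psi> y + ereal (1 / (2 * \<eta>) * (norm (y - w))\<^sup>2 + v \<bullet> y)) E"

definition svrg_gradient ::
  "'a::real_inner set \<Rightarrow> nat \<Rightarrow> (nat \<Rightarrow> 'a \<Rightarrow> real) \<Rightarrow> nat pmf \<Rightarrow> 'a \<Rightarrow> 'a \<Rightarrow> nat \<Rightarrow> 'a" where
  "svrg_gradient E n f P w0 w i =
     gradient_on E (favg n f) w0 +
     (1 / (real n * pmf P i)) *\<^sub>R (gradient_on E (f i) w - gradient_on E (f i) w0)"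

text \<open>The law of the inner iterate of index t within an epoch that starts at w0.\<close>

primrec svrg_inner ::
  "'a::real_inner set \<Rightarrow> nat \<Rightarrow> (nat \<Rightarrow> 'a \<Rightarrow> real) \<Rightarrow> ('a \<Rightarrow> ereal) \<Rightarrow> nat pmf \<Rightarrow> real \<Rightarrow> 'a \<Rightarrow> nat \<Rightarrow> 'a pmf"
where
  "svrg_inner E n f \<psi> P \<eta> w0 0 = return_pmf w0"
| "svrg_inner E n f \<psi> P \<eta> w0 (Suc t) =
     bind_pmf (svrg_inner E n f \<psi> P \<eta> w0 t) (\<lambda>w.
     map_pmf (\<lambda>i. prox_step E \<psi> \<eta> (svrg_gradient E n f P w0 w i) w) P)"

text \<open>
  The library's geometric distribution lives on 0, 1, 2, ... and has mean m - 1 for success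
  probability 1/m; the shift by one gives the distribution on 1, 2, ... with mean m.
\<close>

definition epoch_length :: "real \<Rightarrow> nat pmf" where
  "epoch_length m = map_pmf Suc (geometric_pmf (1 / m))"

text \<open>
  The joint law of the iterate after k epochs and the number of component gradients evaluated so
  far. An epoch of length M costs n for the full gradient and two evaluations in each of the inner
  steps t = 0, ..., M.
\<close>

primrec prox_svrg ::
  "'a::real_inner set \<Rightarrow> nat \<Rightarrow> (nat \<Rightarrow> 'a \<Rightarrow> real) \<Rightarrow> ('a \<Rightarrow> ereal) \<Rightarrow> nat pmf \<Rightarrow>
   'a \<Rightarrow> real \<Rightarrow> real \<Rightarrow> nat \<Rightarrow> ('a \<times> nat) pmf"
where
  "prox_svrg E n f \<psi> P x0 \<eta> m 0 = return_pmf (x0, 0)"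
| "prox_svrg E n f \<psi> P x0 \<eta> m (Suc k) =
     bind_pmf (prox_svrg E n f \<psi> P x0 \<eta> m k) (\<lambda>(x, c).
     bind_pmf (epoch_length m) (\<lambda>M.
     map_pmf (\<lambda>w. (w, c + n + 2 * (M + 1))) (svrg_inner E n f \<psi> P \<eta> x (M + 1))))"

text \<open>
  Expectations of nonnegative quantities are taken in ennreal, so they exist without integrability
  assumptions, also when the objective is infinite at some points.
\<close>

definition expected_gap ::
  "nat \<Rightarrow> (nat \<Rightarrow> 'a \<Rightarrow> real) \<Rightarrow> ('a \<Rightarrow> ereal) \<Rightarrow> 'a \<Rightarrow> ('a \<times> nat) pmf \<Rightarrow> ennreal" where
  "expected_gap n f \<psi> xstar D =
     (\<integral>\<^sup>+ (x, c). e2ennreal (objective n f \<psi> x - objective n f \<psi> xstar) \<partial>measure_pmf D)"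

definition expected_cost :: "('a \<times> nat) pmf \<Rightarrow> ennreal" where
  "expected_cost D = (\<integral>\<^sup>+ (x, c). of_nat c \<partial>measure_pmf D)"

definition svrg_m :: "nat \<Rightarrow> real \<Rightarrow> real" where
  "svrg_m n \<kappa> = real n + 121 * \<kappa>"

definition svrg_eta :: "nat \<Rightarrow> real \<Rightarrow> real \<Rightarrow> real" where
  "svrg_eta n \<kappa> LQ = \<kappa> powr (1/2) * svrg_m n \<kappa> powr (-1/2) / (2 * LQ)"

end

theory Submission
  imports Defs
begin

text \<open>
  Write r for the square root of kappa / m, so r \<le> 1/11 and \<eta> L_Q = r/2. By cocoercivity of the
  component gradients, the variance of the gradient estimator at w is at most 4 L_Q times the sum of
  the gaps at w and at the snapshot w0. The prox inequality then gives, for the expected gap a t and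
  the expectation d t of |w_t - x*|^2 / (2 \<eta>),
  a (t + 1) + d (t + 1) \<le> d t + c (a t + a 0) with c \<le> (22/21) r. Averaging over the geometric epoch
  length turns the telescoping difference into at most d 1 / m, strong convexity gives
  d 0 / m \<le> 2 r a 0, and so one epoch contracts the expected gap by 10 r, which is the claimed rate.
  For the complexity, ln (1 / (10 r)) is at least a constant multiple of 1 + (ln (n / kappa))_+.
\<close>

text \<open>The step size is a compromise. Sampling noise contributes \<open>c\<close>, roughly 2 *
  \<eta> * LQ, and strong convexity contributes 1 / (\<eta> * \<mu> * m); their product is about 2 *
  kappa / m whatever \<eta> is. With \<eta> * LQ = r / 2 the first is about r and the second exactly
  2 * r. Stopping at a geometric time takes the place of averaging iterates: the weights (1 - 1/m)^N
  decrease, so the weighted differences of d telescope to an upper bound, and the last iterate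
  inherits it directly. Two things obstruct. The output has index at least 2, so the telescoped sum
  is bounded by d 1, while strong convexity controls d 0; the first inner step is accounted for
  separately. And the gap at the current iterate stands on the right of the recursion, so a shifted
  copy of the sum being estimated comes back; it is absorbed because c is well below 1. That
  smallness comes from r \<le> 1/11, which is the role of the 121 in m.\<close>

section \<open>Smooth convex functions on a subspace\<close>

text \<open>The ambient space may be incomplete, so limits have to be found inside the subspace.
  Completeness comes from the real line: the coordinates along an orthogonal spanning set form real
  Cauchy sequences.\<close>

lemma Cauchy_span_finite_converges:
  fixes B :: "'a::real_inner set"
  assumes "finite B" and s: "\<And>k. s k \<in> span B" and "Cauchy s"
  shows "\<exists>l\<in>span B. s \<longlonglongrightarrow> l"
proof -
  obtain C where C: "finite C" "span C = span B" "pairwise orthogonal C"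
    using basis_orthogonal[OF assms(1)] by auto
  \<comment> \<open>\<open>C\<close> may contain the zero vector. Its coefficient is then 0 / 0, but
    it multiplies the zero vector, so the expansion still holds.\<close>
  have expand: "x = (\<Sum>b\<in>C. ((x \<bullet> b) / (b \<bullet> b)) *\<^sub>R b)" if x: "x \<in> span C" for x
  proof -
    obtain u where u: "x = (\<Sum>v\<in>C. u v *\<^sub>R v)"
      using x C(1) by (auto simp: span_finite)
    have "x \<bullet> b = u b * (b \<bullet> b)" if "b \<in> C" for b
    proof -
      have "x \<bullet> b = (\<Sum>v\<in>C. u v * (v \<bullet> b))"
        by (simp add: u inner_sum_left)
      also have "\<dots> = (\<Sum>v\<in>C. if v = b then u b * (b \<bullet> b) else 0)"
        using C(3) that by (intro sum.cong) (auto simp: pairwise_def orthogonal_def)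
      finally show ?thesis
        using C(1) that by simp
    qed
    then have "(\<Sum>b\<in>C. ((x \<bullet> b) / (b \<bullet> b)) *\<^sub>R b) = (\<Sum>b\<in>C. u b *\<^sub>R b)"
      by (intro sum.cong) auto
    then show ?thesis
      by (simp add: u)
  qed
  have "Cauchy (\<lambda>k. s k \<bullet> b)" for b
    by (rule bounded_linear.Cauchy[OF bounded_linear_inner_left \<open>Cauchy s\<close>])
  then have lim: "(\<lambda>k. s k \<bullet> b) \<longlonglongrightarrow> lim (\<lambda>k. s k \<bullet> b)" for b
    using Cauchy_convergent convergent_LIMSEQ_iff by blast
  define l where "l = (\<Sum>b\<in>C. (lim (\<lambda>k. s k \<bullet> b) / (b \<bullet> b)) *\<^sub>R b)"
  have "(\<lambda>k. \<Sum>b\<in>C. ((s k \<bullet> b) / (b \<bullet> b)) *\<^sub>R b) \<longlonglongrightarrow> l"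
    unfolding l_def divide_inverse by (intro tendsto_intros lim)
  moreover have "(\<Sum>b\<in>C. ((s k \<bullet> b) / (b \<bullet> b)) *\<^sub>R b) = s k" for k
    using expand[of "s k"] s C(2) by auto
  ultimately have "s \<longlonglongrightarrow> l"
    by simp
  moreover have "l \<in> span B"
    unfolding l_def C(2)[symmetric] by (intro span_sum span_scale span_base)
  ultimately show ?thesis
    by blast
qed

text \<open>Calculus is done on lines: a line through a point of \<open>E\<close> in a direction of
  \<open>E\<close> stays in \<open>E\<close>, so a derivative within \<open>E\<close> restricts to
  an ordinary derivative of a real function.\<close>

lemma has_derivative_along_line:
  fixes f :: "'a::real_inner \<Rightarrow> real"
  assumes "subspace E" "x \<in> E" "d \<in> E"
    and f: "(f has_derivative (\<lambda>h. g \<bullet> h)) (at (x + t *\<^sub>R d) within E)"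
  shows "((\<lambda>s. f (x + s *\<^sub>R d)) has_real_derivative g \<bullet> d) (at t)"
proof -
  have sub: "range (\<lambda>s::real. x + s *\<^sub>R d) \<subseteq> E"
    using assms by (auto intro: subspace_add subspace_scale)
  have "((\<lambda>s. x + s *\<^sub>R d) has_derivative (\<lambda>h. h *\<^sub>R d)) (at t)"
    by (auto intro!: derivative_eq_intros)
  from has_derivative_in_compose[OF this has_derivative_subset[OF f sub]]
  have "((\<lambda>s. f (x + s *\<^sub>R d)) has_derivative (\<lambda>h. g \<bullet> (h *\<^sub>R d))) (at t)" .
  then show ?thesis
    by (simp add: has_field_derivative_def mult.commute[of _ "g \<bullet> d"])
qed

text \<open>Two candidates both lie in \<open>E\<close>, so their difference is an admissible
  direction; equality of the derivatives along it makes its norm zero.\<close>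

lemma gradient_on_eq:
  fixes f :: "'a::real_inner \<Rightarrow> real"
  assumes E: "subspace E" "x \<in> E" and g: "g \<in> E"
    and f: "(f has_derivative (\<lambda>h. g \<bullet> h)) (at x within E)"
  shows "gradient_on E f x = g"
  unfolding gradient_on_def
proof (rule the_equality)
  fix g' assume g': "g' \<in> E \<and> (f has_derivative (\<lambda>h. g' \<bullet> h)) (at x within E)"
  define d where "d = g' - g"
  have d: "d \<in> E"
    using E(1) g g' by (auto simp: d_def subspace_diff)
  have "((\<lambda>s. f (x + s *\<^sub>R d)) has_real_derivative g \<bullet> d) (at 0)"
    by (rule has_derivative_along_line[OF E d]) (use f in simp)
  moreover have "((\<lambda>s. f (x + s *\<^sub>R d)) has_real_derivative g' \<bullet> d) (at 0)"
    by (rule has_derivative_along_line[OF E d]) (use g' in simp)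
  ultimately have "g \<bullet> d = g' \<bullet> d"
    by (rule DERIV_unique)
  then have "d \<bullet> d = 0"
    by (simp add: d_def inner_diff)
  then show "g' = g"
    by (simp add: d_def)
qed (use assms in auto)

lemma convex_on_ge_linearization:
  fixes f :: "'a::real_inner \<Rightarrow> real"
  assumes E: "subspace E" "x \<in> E" "y \<in> E" and f: "convex_on E f"
    and deriv: "(f has_derivative (\<lambda>h. g \<bullet> h)) (at x within E)"
  shows "f x + g \<bullet> (y - x) \<le> f y"
proof -
  define d where "d = y - x"
  define \<phi> where "\<phi> = (\<lambda>s. f (x + s *\<^sub>R d))"
  have d: "d \<in> E"
    using E by (simp add: d_def subspace_diff)
  have line: "x + s *\<^sub>R d \<in> E" for s
    using E d by (auto intro: subspace_add subspace_scale)
  have "convex_on UNIV \<phi>"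
  proof (intro convex_onI)
    fix t a b :: real
    assume t: "0 < t" "t < 1"
    have "x + ((1 - t) *\<^sub>R a + t *\<^sub>R b) *\<^sub>R d = (1 - t) *\<^sub>R (x + a *\<^sub>R d) + t *\<^sub>R (x + b *\<^sub>R d)"
      by (simp add: algebra_simps)
    then show "\<phi> ((1 - t) *\<^sub>R a + t *\<^sub>R b) \<le> (1 - t) * \<phi> a + t * \<phi> b"
      unfolding \<phi>_def using convex_onD[OF f, of t "x + a *\<^sub>R d" "x + b *\<^sub>R d"] t line by simp
  qed simp
  moreover have "(\<phi> has_real_derivative g \<bullet> d) (at 0)"
    unfolding \<phi>_def by (rule has_derivative_along_line[OF E(1,2) d]) (use deriv in simp)
  ultimately have "\<phi> 1 - \<phi> 0 \<ge> (g \<bullet> d) * (1 - 0)"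
    by (intro convex_on_imp_above_tangent[of UNIV]) auto
  then show ?thesis
    by (simp add: \<phi>_def d_def)
qed

text \<open>The descent lemma without integration: along the segment, \<open>f\<close> minus the
  claimed quadratic has nonpositive derivative by Cauchy-Schwarz and the Lipschitz bound.\<close>

lemma lipschitz_gradient_upper_bound:
  fixes f :: "'a::real_inner \<Rightarrow> real"
  assumes E: "subspace E" "x \<in> E" "y \<in> E"
    and deriv: "\<And>z. z \<in> E \<Longrightarrow> (f has_derivative (\<lambda>h. g z \<bullet> h)) (at z within E)"
    and lip: "K-lipschitz_on E g"
  shows "f y \<le> f x + g x \<bullet> (y - x) + K / 2 * (norm (y - x))\<^sup>2"
proof -
  define d where "d = y - x"
  have d: "d \<in> E"
    using E by (simp add: d_def subspace_diff)
  have line: "x + s *\<^sub>R d \<in> E" for s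
    using E d by (auto intro: subspace_add subspace_scale)
  define \<theta> where "\<theta> = (\<lambda>s. f (x + s *\<^sub>R d) - s * (g x \<bullet> d) - K / 2 * s\<^sup>2 * (norm d)\<^sup>2)"
  have \<theta>: "(\<theta> has_real_derivative (g (x + s *\<^sub>R d) \<bullet> d - g x \<bullet> d - K * s * (norm d)\<^sup>2)) (at s)" for s
    unfolding \<theta>_def
    by (auto intro!: derivative_eq_intros has_derivative_along_line[OF E(1,2) d] deriv line)
  have "\<theta> 1 \<le> \<theta> 0"
  proof (rule DERIV_nonpos_imp_nonincreasing[of 0 1 \<theta>])
    fix s :: real assume s: "0 \<le> s" "s \<le> 1"
    have "g (x + s *\<^sub>R d) \<bullet> d - g x \<bullet> d = (g (x + s *\<^sub>R d) - g x) \<bullet> d"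
      by (simp add: inner_diff_left)
    also have "\<dots> \<le> norm (g (x + s *\<^sub>R d) - g x) * norm d"
      by (rule norm_cauchy_schwarz)
    also have "\<dots> \<le> (K * (s * norm d)) * norm d"
      using lipschitz_onD[OF lip line[of s] E(2)] s
      by (intro mult_right_mono) (auto simp: dist_norm)
    finally have "g (x + s *\<^sub>R d) \<bullet> d - g x \<bullet> d - K * s * (norm d)\<^sup>2 \<le> 0"
      by (simp add: power2_eq_square mult_ac)
    then show "\<exists>z. (\<theta> has_real_derivative z) (at s) \<and> z \<le> 0"
      using \<theta> by blast
  qed simp
  then show ?thesis
    by (simp add: \<theta>_def d_def)
qed

text \<open>After subtraction of its linearization at \<open>x\<close>, \<open>f\<close> is minimal
  at \<open>x\<close>. A gradient step of length 1 / K from \<open>y\<close> cannot get below this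
  minimum, yet the descent lemma guarantees a decrease by the squared gradient difference over 2 *
  K.\<close>

lemma convex_lipschitz_gradient_cocoercive:
  fixes f :: "'a::real_inner \<Rightarrow> real"
  assumes E: "subspace E" "x \<in> E" "y \<in> E" and f: "convex_on E f"
    and deriv: "\<And>z. z \<in> E \<Longrightarrow> (f has_derivative (\<lambda>h. g z \<bullet> h)) (at z within E)"
    and g: "\<And>z. z \<in> E \<Longrightarrow> g z \<in> E"
    and lip: "K-lipschitz_on E g" and K: "0 < K"
  shows "(norm (g y - g x))\<^sup>2 \<le> 2 * K * (f y - f x - g x \<bullet> (y - x))"
proof -
  define z where "z = y - (1 / K) *\<^sub>R (g y - g x)"
  have z: "z \<in> E"
    using E g by (auto simp: z_def intro!: subspace_diff subspace_scale)
  have "f x + g x \<bullet> (z - x) \<le> f z"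
    by (rule convex_on_ge_linearization[OF E(1,2) z f deriv[OF E(2)]])
  also have "f z \<le> f y + g y \<bullet> (z - y) + K / 2 * (norm (z - y))\<^sup>2"
    by (rule lipschitz_gradient_upper_bound[OF E(1,3) z deriv lip])
  finally have "f x + g x \<bullet> (z - y) + g x \<bullet> (y - x) \<le> f y + g y \<bullet> (z - y) + K / 2 * (norm (z - y))\<^sup>2"
    by (simp add: inner_diff_right)
  moreover have "z - y = - ((1 / K) *\<^sub>R (g y - g x))"
    by (simp add: z_def)
  moreover have "g y \<bullet> (z - y) - g x \<bullet> (z - y) = - ((1 / K) * (norm (g y - g x))\<^sup>2)"
    unfolding \<open>z - y = _\<close> inner_diff_left[symmetric] by (simp add: power2_norm_eq_inner)
  ultimately have "(1 / K) * (norm (g y - g x))\<^sup>2 - K / 2 * ((1 / K)\<^sup>2 * (norm (g y - g x))\<^sup>2)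
      \<le> f y - f x - g x \<bullet> (y - x)"
    using K by (simp add: power_mult_distrib power_divide)
  moreover have "(1 / K) * (norm (g y - g x))\<^sup>2 - K / 2 * ((1 / K)\<^sup>2 * (norm (g y - g x))\<^sup>2)
      = (norm (g y - g x))\<^sup>2 / (2 * K)"
    using K by (simp add: field_simps power2_eq_square)
  ultimately have "(norm (g y - g x))\<^sup>2 / (2 * K) \<le> f y - f x - g x \<bullet> (y - x)"
    by simp
  then show ?thesis
    using K by (simp add: divide_le_eq mult.commute mult.left_commute)
qed

section \<open>The proximal step\<close>

lemma proper_closed_convex_on_le:
  fixes \<psi> :: "'a::real_inner \<Rightarrow> ereal"
  assumes \<psi>: "proper_closed_convex_on E \<psi>" and E: "subspace E" "x \<in> E" "y \<in> E"
    and x: "\<psi> x = ereal a" and y: "\<psi> y = ereal b" and t: "0 \<le> t" "t \<le> 1"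
  shows "\<psi> (x + t *\<^sub>R (y - x)) \<le> ereal (a + t * (b - a))"
proof -
  have "convex (epigraph_on E \<psi>)"
    using \<psi> by (simp add: proper_closed_convex_on_def)
  moreover have "(x, a) \<in> epigraph_on E \<psi>" "(y, b) \<in> epigraph_on E \<psi>"
    using E x y by (auto simp: epigraph_on_def)
  ultimately have "(1 - t) *\<^sub>R (x, a) + t *\<^sub>R (y, b) \<in> epigraph_on E \<psi>"
    using t by (intro convexD) auto
  moreover have "(1 - t) *\<^sub>R (x, a) + t *\<^sub>R (y, b) = (x + t *\<^sub>R (y - x), a + t * (b - a))"
    by (simp add: algebra_simps)
  ultimately show ?thesis
    by (simp add: epigraph_on_def)
qed

text \<open>First-order optimality: -g is a subgradient of \<psi> at \<open>x\<close>. Otherwise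
  \<open>\<phi>\<close>, which by convexity of \<psi> dominates the objective on the segment up to a
  constant, would start with negative slope. Applied both to the prox objective and to
  \<open>xstar\<close>.\<close>

lemma composite_minimizer_subgradient:
  fixes \<psi> :: "'a::real_inner \<Rightarrow> ereal" and q :: "'a \<Rightarrow> real"
  assumes \<psi>: "proper_closed_convex_on E \<psi>" and E: "subspace E" "x \<in> E" "y \<in> E"
    and x: "\<psi> x = ereal a" and y: "\<psi> y = ereal b"
    and deriv: "(q has_derivative (\<lambda>h. g \<bullet> h)) (at x within E)"
    and min: "\<And>z. z \<in> E \<Longrightarrow> \<psi> x + ereal (q x) \<le> \<psi> z + ereal (q z)"
  shows "a \<le> b + g \<bullet> (y - x)"
proof (rule ccontr)
  assume neg: "\<not> a \<le> b + g \<bullet> (y - x)"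
  define d where "d = y - x"
  have d: "d \<in> E"
    using E by (simp add: d_def subspace_diff)
  define \<phi> where "\<phi> = (\<lambda>s. q (x + s *\<^sub>R d) + s * (b - a))"
  have "((\<lambda>s. q (x + s *\<^sub>R d)) has_real_derivative g \<bullet> d) (at 0)"
    by (rule has_derivative_along_line[OF E(1,2) d]) (use deriv in simp)
  then have "(\<phi> has_real_derivative (g \<bullet> d + (b - a))) (at 0)"
    unfolding \<phi>_def by (auto intro!: derivative_eq_intros)
  then obtain \<delta> where \<delta>: "0 < \<delta>" "\<And>h. 0 < h \<Longrightarrow> h < \<delta> \<Longrightarrow> \<phi> (0 + h) < \<phi> 0"
    using DERIV_neg_dec_right[of \<phi> "g \<bullet> d + (b - a)" 0] neg unfolding d_def by force
  define h where "h = min (1/2) (\<delta> / 2)"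
  have h: "0 < h" "h < \<delta>" "h \<le> 1"
    using \<delta>(1) by (auto simp: h_def)
  have z: "x + h *\<^sub>R d \<in> E"
    using E d by (auto intro: subspace_add subspace_scale)
  have "ereal (a + q x) \<le> \<psi> (x + h *\<^sub>R d) + ereal (q (x + h *\<^sub>R d))"
    using min[OF z] x by simp
  also have "\<dots> \<le> ereal (a + h * (b - a)) + ereal (q (x + h *\<^sub>R d))"
    unfolding d_def by (intro add_right_mono proper_closed_convex_on_le[OF \<psi> E x y]) (use h in auto)
  finally have "\<phi> 0 \<le> \<phi> h"
    by (simp add: \<phi>_def)
  then show False
    using \<delta>(2)[OF h(1,2)] by simp
qed

lemma sq_norm_midpoint:
  fixes y z w :: "'a::real_inner"
  shows "(norm ((1/2) *\<^sub>R (y + z) - w))\<^sup>2 =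
    ((norm (y - w))\<^sup>2 + (norm (z - w))\<^sup>2) / 2 - (norm (y - z))\<^sup>2 / 4"
  by (simp add: power2_norm_eq_inner inner_diff_left inner_diff_right inner_add_left inner_add_right
      inner_commute field_simps)

text \<open>The direct method: strong convexity of the quadratic makes a minimizing sequence Cauchy,
  finite dimension gives a limit in \<open>E\<close>, and the closed epigraph makes \<psi> lower
  semicontinuous there.\<close>

lemma prox_step_minimizer:
  fixes \<psi> :: "'a::real_inner \<Rightarrow> ereal"
  assumes \<psi>: "proper_closed_convex_on E \<psi>" and fin: "finite B" "span B = E"
    and \<eta>: "0 < \<eta>"
    and bdd: "\<And>y. y \<in> E \<Longrightarrow>
      ereal c \<le> \<psi> y + ereal (1 / (2 * \<eta>) * (norm (y - w))\<^sup>2 + v \<bullet> y)"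
  defines "x \<equiv> prox_step E \<psi> \<eta> v w"
  shows "x \<in> E" "\<psi> x \<noteq> \<infinity>"
    and "\<And>y. y \<in> E \<Longrightarrow> \<psi> x + ereal (1 / (2 * \<eta>) * (norm (x - w))\<^sup>2 + v \<bullet> x)
      \<le> \<psi> y + ereal (1 / (2 * \<eta>) * (norm (y - w))\<^sup>2 + v \<bullet> y)"
proof -
  define q where "q = (\<lambda>y. 1 / (2 * \<eta>) * (norm (y - w))\<^sup>2 + v \<bullet> y)"
  define r where "r = (\<lambda>y. real_of_ereal (\<psi> y))"
  define D where "D = {y \<in> E. \<psi> y \<noteq> \<infinity>}"
  define H where "H = (\<lambda>y. r y + q y)"
  have E: "subspace E"
    using fin by auto
  have minf: "\<psi> y \<noteq> -\<infinity>" if "y \<in> E" for y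
    using \<psi> that by (auto simp: proper_closed_convex_on_def)
  have r: "\<psi> y = ereal (r y)" if "y \<in> D" for y
    using that minf[of y] by (auto simp: D_def r_def ereal_real)
  have D_ne: "D \<noteq> {}"
    using \<psi> by (auto simp: D_def proper_closed_convex_on_def)
  have lb: "c \<le> H y" if "y \<in> D" for y
    using bdd[of y] r[OF that] that by (auto simp: D_def H_def q_def)
  then have bb: "bdd_below (H ` D)"
    by (intro bdd_belowI[of _ c]) auto
  define I where "I = Inf (H ` D)"
  have I: "I \<le> H y" if "y \<in> D" for y
    unfolding I_def using bb that by (auto intro: cInf_lower)
  have "\<exists>y\<in>D. H y < I + 1 / real (Suc k)" for k
  proof -
    have "\<exists>h\<in>H ` D. h < I + 1 / real (Suc k)"
      by (rule cInf_lessD) (use D_ne in \<open>auto simp: I_def\<close>)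
    then show ?thesis
      by auto
  qed
  then obtain s where s: "\<And>k. s k \<in> D" "\<And>k. H (s k) < I + 1 / real (Suc k)"
    by metis
  \<comment> \<open>The objective at the midpoint is at least the infimum \<open>I\<close>, but it
    lies below the mean of the two values by a multiple of the squared distance; so two nearly
    minimal points are close.\<close>
  have near: "(norm (y - z))\<^sup>2 \<le> 4 * \<eta> * (H y + H z - 2 * I)" if y: "y \<in> D" and z: "z \<in> D" for y z
  proof -
    define p where "p = (1/2) *\<^sub>R (y + z)"
    have pE: "p \<in> E"
      using E y z by (auto simp: p_def D_def intro!: subspace_scale subspace_add)
    have "y + (1/2) *\<^sub>R (z - y) = p"
      by (simp add: p_def algebra_simps flip: scaleR_add_left)
    then have \<psi>p: "\<psi> p \<le> ereal ((r y + r z) / 2)"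
      using proper_closed_convex_on_le[OF \<psi> E _ _ r[OF y] r[OF z], of "1/2"] y z
      by (simp add: D_def field_simps)
    then have p: "p \<in> D"
      using pE by (auto simp: D_def)
    have "I \<le> r p + q p"
      using I[OF p] by (simp add: H_def)
    also have "r p \<le> (r y + r z) / 2"
      using \<psi>p r[OF p] by simp
    also have "q p = (q y + q z) / 2 - (norm (y - z))\<^sup>2 / (8 * \<eta>)"
    proof -
      have vp: "v \<bullet> p = (v \<bullet> y + v \<bullet> z) / 2"
        by (simp add: p_def inner_add_right)
      have norm_p: "(norm (p - w))\<^sup>2 = ((norm (y - w))\<^sup>2 + (norm (z - w))\<^sup>2) / 2 - (norm (y - z))\<^sup>2 / 4"
        unfolding p_def by (rule sq_norm_midpoint)
      show ?thesis
        unfolding q_def vp norm_p using \<eta> by (simp add: field_simps)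
    qed
    finally have "I \<le> (H y + H z) / 2 - (norm (y - z))\<^sup>2 / (8 * \<eta>)"
      by (simp add: H_def field_simps)
    then show ?thesis
      using \<eta> by (simp add: field_simps)
  qed
  have "Cauchy s"
  proof (rule CauchyI')
    fix e :: real assume e: "0 < e"
    obtain N where N: "8 * \<eta> / e\<^sup>2 < real (Suc N)"
      using reals_Archimedean2 by (metis less_Suc_eq of_nat_less_iff order_less_trans)
    then have N': "8 * \<eta> / real (Suc N) < e\<^sup>2"
      using e \<eta> by (simp add: field_simps)
    have "dist (s i) (s j) < e" if ij: "N \<le> i" "i < j" for i j
    proof -
      have inv: "1 / real (Suc i) \<le> 1 / real (Suc N)" "1 / real (Suc j) \<le> 1 / real (Suc N)"
        using ij by (auto simp: field_simps)
      have "(norm (s i - s j))\<^sup>2 \<le> 4 * \<eta> * (H (s i) + H (s j) - 2 * I)"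
        by (rule near[OF s(1) s(1)])
      also have "\<dots> \<le> 4 * \<eta> * (2 / real (Suc N))"
        using s(2)[of i] s(2)[of j] inv \<eta> by (intro mult_left_mono) linarith+
      also have "\<dots> < e\<^sup>2"
        using N' by simp
      finally show ?thesis
        using e by (simp add: dist_norm power2_less_imp_less)
    qed
    then show "\<exists>M. \<forall>m\<ge>M. \<forall>n>m. dist (s m) (s n) < e"
      by blast
  qed
  then obtain l where l: "l \<in> E" "s \<longlonglongrightarrow> l"
    using Cauchy_span_finite_converges[OF fin(1), of s] s(1) fin(2) by (auto simp: D_def)
  have "(\<lambda>k. H (s k)) \<longlonglongrightarrow> I"
  proof (rule tendsto_sandwich[OF _ _ tendsto_const])
    show "\<forall>\<^sub>F k in sequentially. I \<le> H (s k)"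
      using I s(1) by simp
    show "\<forall>\<^sub>F k in sequentially. H (s k) \<le> I + 1 / real (Suc k)"
      using s(2) by (auto intro: less_imp_le always_eventually)
    show "(\<lambda>k. I + 1 / real (Suc k)) \<longlonglongrightarrow> I"
      using tendsto_add[OF tendsto_const[of I] LIMSEQ_inverse_real_of_nat]
      by (simp add: inverse_eq_divide)
  qed
  moreover have "(\<lambda>k. q (s k)) \<longlonglongrightarrow> q l"
    unfolding q_def by (intro tendsto_intros l(2))
  \<comment> \<open>\<open>H (s k) - q (s k)\<close> is the value of \<psi> at \<open>s k\<close>,
    so these pairs lie on the boundary of the epigraph and their limit stays in it.\<close>
  ultimately have lim: "(\<lambda>k. (s k, H (s k) - q (s k))) \<longlonglongrightarrow> (l, I - q l)"
    by (intro tendsto_intros l(2))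
  have epi: "(s k, H (s k) - q (s k)) \<in> epigraph_on E \<psi>" for k
    using s(1)[of k] r[OF s(1)[of k]] by (simp add: epigraph_on_def H_def D_def)
  have "closed (epigraph_on E \<psi>)"
    using \<psi> by (simp add: proper_closed_convex_on_def)
  from closed_sequentially[OF this epi lim] have "(l, I - q l) \<in> epigraph_on E \<psi>" .
  then have l_le: "\<psi> l \<le> ereal (I - q l)"
    by (simp add: epigraph_on_def)
  then have lD: "l \<in> D"
    using l(1) by (auto simp: D_def)
  have l_min: "\<psi> l + ereal (q l) \<le> \<psi> y + ereal (q y)" if "y \<in> E" for y
  proof (cases "y \<in> D")
    case True
    have "\<psi> l + ereal (q l) \<le> ereal (I - q l) + ereal (q l)"
      by (intro add_right_mono l_le)
    also have "\<dots> = ereal I"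
      by simp
    also have "\<dots> \<le> ereal (H y)"
      using I[OF True] by simp
    finally show ?thesis
      by (simp add: H_def r[OF True])
  qed (use that in \<open>auto simp: D_def\<close>)
  \<comment> \<open>\<open>prox_step\<close> is an arbitrary choice among minimizers, so exhibiting
    the minimizer \<open>l\<close> is enough for the chosen point to be one.\<close>
  have "is_arg_min (\<lambda>y. \<psi> y + ereal (q y)) (\<lambda>y. y \<in> E) l"
    using l(1) l_min by (auto simp: is_arg_min_def not_less)
  then have "is_arg_min (\<lambda>y. \<psi> y + ereal (q y)) (\<lambda>y. y \<in> E) x"
    unfolding x_def prox_step_def arg_min_on_def arg_min_def q_def by (rule someI)
  then have x: "x \<in> E" "\<And>y. y \<in> E \<Longrightarrow> \<psi> x + ereal (q x) \<le> \<psi> y + ereal (q y)"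
    by (auto simp: is_arg_min_linorder)
  then show "x \<in> E" and "\<And>y. y \<in> E \<Longrightarrow> \<psi> x + ereal (1 / (2 * \<eta>) * (norm (x - w))\<^sup>2 + v \<bullet> x)
      \<le> \<psi> y + ereal (1 / (2 * \<eta>) * (norm (y - w))\<^sup>2 + v \<bullet> y)"
    by (auto simp: q_def)
  show "\<psi> x \<noteq> \<infinity>"
    using x(2)[OF l(1)] r[OF lD] by auto
qed

text \<open>The three-point inequality: optimality of \<open>x\<close> for the prox objective, with
  the inner product of x - w and u - x expanded into squared distances.\<close>

lemma prox_step_inequality:
  fixes \<psi> :: "'a::real_inner \<Rightarrow> ereal"
  assumes \<psi>: "proper_closed_convex_on E \<psi>" and E: "subspace E" "x \<in> E" "u \<in> E" and \<eta>: "0 < \<eta>"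
    and x: "\<psi> x = ereal a" and u: "\<psi> u = ereal b"
    and min: "\<And>y. y \<in> E \<Longrightarrow> \<psi> x + ereal (1 / (2 * \<eta>) * (norm (x - w))\<^sup>2 + v \<bullet> x)
      \<le> \<psi> y + ereal (1 / (2 * \<eta>) * (norm (y - w))\<^sup>2 + v \<bullet> y)"
  shows "a \<le> b + v \<bullet> (u - x)
      + ((norm (u - w))\<^sup>2 - (norm (x - w))\<^sup>2 - (norm (u - x))\<^sup>2) / (2 * \<eta>)"
proof -
  have "((\<lambda>y. 1 / (2 * \<eta>) * (norm (y - w))\<^sup>2 + v \<bullet> y) has_derivative
      (\<lambda>h. ((1 / \<eta>) *\<^sub>R (x - w) + v) \<bullet> h)) (at x within E)"
    unfolding power2_norm_eq_inner
    using \<eta> by (auto intro!: derivative_eq_intros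
      simp: fun_eq_iff inner_add_left inner_add_right inner_diff_left inner_diff_right
        inner_commute field_simps)
  from composite_minimizer_subgradient[OF \<psi> E x u this min]
  have "a \<le> b + ((1 / \<eta>) *\<^sub>R (x - w) + v) \<bullet> (u - x)" .
  moreover have "(x - w) \<bullet> (u - x) = ((norm (u - w))\<^sup>2 - (norm (x - w))\<^sup>2 - (norm (u - x))\<^sup>2) / 2"
    by (simp add: power2_norm_eq_inner inner_diff_left inner_diff_right inner_commute)
  ultimately show ?thesis
    unfolding inner_add_left inner_scaleR_left by simp
qed

section \<open>One inner iteration\<close>

lemma sum_weighted_variance_le:
  fixes X :: "'i \<Rightarrow> 'a::real_inner"
  assumes "sum p S = 1" and mean: "(\<Sum>i\<in>S. p i *\<^sub>R X i) = m"
  shows "(\<Sum>i\<in>S. p i * (norm (m - X i))\<^sup>2) \<le> (\<Sum>i\<in>S. p i * (norm (X i))\<^sup>2)"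
proof -
  have "(\<Sum>i\<in>S. p i * (X i \<bullet> m)) = m \<bullet> m"
    by (simp add: mean[symmetric] inner_sum_left)
  moreover have "(\<Sum>i\<in>S. p i * (norm (m - X i))\<^sup>2)
      = (\<Sum>i\<in>S. p i * (m \<bullet> m) - 2 * (p i * (X i \<bullet> m)) + p i * (norm (X i))\<^sup>2)"
    by (intro sum.cong) (auto simp: power2_norm_eq_inner inner_diff inner_commute algebra_simps)
  ultimately have "(\<Sum>i\<in>S. p i * (norm (m - X i))\<^sup>2) = (\<Sum>i\<in>S. p i * (norm (X i))\<^sup>2) - m \<bullet> m"
    using assms(1)
    by (simp add: sum.distrib sum_subtractf flip: sum_distrib_left sum_distrib_right)
  then show ?thesis
    by simp
qed

lemma sq_norm_diff_le:
  fixes a b :: "'a::real_inner"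
  shows "(norm (a - b))\<^sup>2 \<le> 2 * (norm a)\<^sup>2 + 2 * (norm b)\<^sup>2"
proof -
  have "(norm (a - b))\<^sup>2 + (norm (a + b))\<^sup>2 = 2 * (norm a)\<^sup>2 + 2 * (norm b)\<^sup>2"
    by (simp add: power2_norm_eq_inner inner_diff inner_add inner_commute)
  then show ?thesis
    using zero_le_power2[of "norm (a + b)"] by linarith
qed

lemma inner_le_weighted_squares:
  fixes a b :: "'a::real_inner"
  assumes "0 < s"
  shows "a \<bullet> b \<le> s * (norm b)\<^sup>2 + (norm a)\<^sup>2 / (4 * s)"
proof -
  have "0 \<le> (norm (a - (2 * s) *\<^sub>R b))\<^sup>2"
    by simp
  also have "\<dots> = (norm a)\<^sup>2 - 4 * s * (a \<bullet> b) + 4 * s\<^sup>2 * (norm b)\<^sup>2"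
    unfolding power2_norm_eq_inner
    by (simp add: inner_diff inner_commute power2_eq_square algebra_simps)
  finally show ?thesis
    using assms by (simp add: field_simps power2_eq_square)
qed

section \<open>Smoothness weighted by the sampling probabilities\<close>

context prox_finite_sum
begin

abbreviation LQ :: real where "LQ \<equiv> L_Q n L P"

abbreviation grad :: "nat \<Rightarrow> 'a \<Rightarrow> 'a" where "grad i \<equiv> gradient_on E (f i)"

abbreviation gradf :: "'a \<Rightarrow> 'a" where "gradf \<equiv> gradient_on E (favg n f)"

definition dom_psi :: "'a set" where "dom_psi = {x \<in> E. \<psi> x \<noteq> \<infinity>}"

text \<open>A real stand-in for F(x) - F(xstar). It has this meaning on \<open>dom_psi\<close> only,
  since \<open>real_of_ereal\<close> sends infinite values to 0.\<close>

definition gap :: "'a \<Rightarrow> real" where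
  "gap x = real_of_ereal (\<psi> x) + favg n f x - (real_of_ereal (\<psi> xstar) + favg n f xstar)"

lemma subspace_E: "subspace E"
  using finite_dim by auto

lemma sum_P: "(\<Sum>i=1..n. pmf P i) = 1"
  by (rule sum_pmf_eq_1) (simp_all add: P_support)

lemma pmf_P_pos: "i \<in> {1..n} \<Longrightarrow> 0 < pmf P i"
  using P_support by (simp add: pmf_positive)

lemma grad_in: "i \<in> {1..n} \<Longrightarrow> x \<in> E \<Longrightarrow> grad i x \<in> E"
  and grad_deriv: "i \<in> {1..n} \<Longrightarrow> x \<in> E \<Longrightarrow> (f i has_derivative (\<lambda>h. grad i x \<bullet> h)) (at x within E)"
  using f_differentiable[of i x] gradient_on_eq[OF subspace_E, of x _ "f i"] by auto

text \<open>The constant is expressed through \<open>LQ\<close> so that the importance weights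
  cancel later; it is also positive where \<open>L i\<close> is 0, as cocoercivity demands.\<close>

lemma grad_lipschitz:
  assumes i: "i \<in> {1..n}"
  shows "(LQ * (real n * pmf P i))-lipschitz_on E (grad i)"
proof (rule lipschitz_on_le[OF f_smooth[OF i]])
  have "L i / (pmf P i * real n) \<le> LQ"
    unfolding L_Q_def using i by (intro Max_ge) auto
  then show "L i \<le> LQ * (real n * pmf P i)"
    using pmf_P_pos[OF i] i by (simp add: field_simps)
qed

lemma gradf_eq: "x \<in> E \<Longrightarrow> gradf x = (1 / real n) *\<^sub>R (\<Sum>i=1..n. grad i x)"
  and gradf_deriv: "x \<in> E \<Longrightarrow> (favg n f has_derivative (\<lambda>h. gradf x \<bullet> h)) (at x within E)"
proof -
  assume x: "x \<in> E"
  define g where "g = (1 / real n) *\<^sub>R (\<Sum>i=1..n. grad i x)"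
  have gE: "g \<in> E"
    unfolding g_def using grad_in x by (intro subspace_scale[OF subspace_E] subspace_sum[OF subspace_E])
  have "((\<lambda>y. 1 / real n * (\<Sum>i=1..n. f i y)) has_derivative
      (\<lambda>h. 1 / real n * (\<Sum>i=1..n. grad i x \<bullet> h))) (at x within E)"
    by (intro has_derivative_mult_right has_derivative_sum grad_deriv x)
  then have deriv: "(favg n f has_derivative (\<lambda>h. g \<bullet> h)) (at x within E)"
    by (simp add: favg_def[abs_def] g_def inner_sum_left)
  have eq: "gradf x = g"
    by (rule gradient_on_eq[OF subspace_E x gE deriv])
  show "gradf x = (1 / real n) *\<^sub>R (\<Sum>i=1..n. grad i x)"
    by (simp add: eq g_def)
  show "(favg n f has_derivative (\<lambda>h. gradf x \<bullet> h)) (at x within E)"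
    using eq deriv by simp
qed

lemma inner_gradf: "x \<in> E \<Longrightarrow> gradf x \<bullet> d = (1 / real n) * (\<Sum>i=1..n. grad i x \<bullet> d)"
  by (simp add: gradf_eq inner_sum_left)

lemma favg_lower:
  assumes "x \<in> E" "y \<in> E"
  shows "favg n f x + gradf x \<bullet> (y - x) \<le> favg n f y"
proof -
  have "(\<Sum>i=1..n. f i x + grad i x \<bullet> (y - x)) \<le> (\<Sum>i=1..n. f i y)"
    using assms by (intro sum_mono convex_on_ge_linearization[OF subspace_E] f_convex grad_deriv)
  then have "1 / real n * (\<Sum>i=1..n. f i x + grad i x \<bullet> (y - x)) \<le> 1 / real n * (\<Sum>i=1..n. f i y)"
    by (intro mult_left_mono) auto
  then show ?thesis
    by (simp add: favg_def inner_gradf assms sum.distrib add_divide_distrib)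
qed

text \<open>The component constants average to \<open>LQ\<close> because the probabilities sum to 1,
  so \<open>LQ\<close> also serves as a smoothness constant of the average.\<close>

lemma favg_upper:
  assumes "x \<in> E" "y \<in> E"
  shows "favg n f y \<le> favg n f x + gradf x \<bullet> (y - x) + LQ / 2 * (norm (y - x))\<^sup>2"
proof -
  define N where "N = LQ / 2 * (norm (y - x))\<^sup>2"
  have "(\<Sum>i=1..n. f i y) \<le> (\<Sum>i=1..n. f i x + grad i x \<bullet> (y - x) + N * real n * pmf P i)"
  proof (rule sum_mono)
    fix i assume i: "i \<in> {1..n}"
    show "f i y \<le> f i x + grad i x \<bullet> (y - x) + N * real n * pmf P i"
      using lipschitz_gradient_upper_bound[OF subspace_E assms grad_deriv[OF i] grad_lipschitz[OF i]]
      by (simp add: N_def mult_ac)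
  qed
  also have "\<dots> = (\<Sum>i=1..n. f i x) + (\<Sum>i=1..n. grad i x \<bullet> (y - x)) + N * real n"
    using sum_P by (simp add: sum.distrib flip: sum_distrib_left)
  finally have "1 / real n * (\<Sum>i=1..n. f i y)
      \<le> 1 / real n * ((\<Sum>i=1..n. f i x) + (\<Sum>i=1..n. grad i x \<bullet> (y - x)) + N * real n)"
    by (intro mult_left_mono) auto
  then show ?thesis
    using n_pos by (simp add: favg_def inner_gradf assms add_divide_distrib N_def)
qed

text \<open>Cocoercivity supplies a factor n * p_i; together with the sampling probability it
  cancels the squared importance weight down to 1 / n, leaving the Bregman distance of the plain
  average.\<close>

lemma sum_scaled_grad_diff_le:
  assumes "x \<in> E" "y \<in> E"
  shows "(\<Sum>i=1..n. pmf P i * (norm ((1 / (real n * pmf P i)) *\<^sub>R (grad i y - grad i x)))\<^sup>2)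
    \<le> 2 * LQ * (favg n f y - favg n f x - gradf x \<bullet> (y - x))"
proof -
  have "(\<Sum>i=1..n. pmf P i * (norm ((1 / (real n * pmf P i)) *\<^sub>R (grad i y - grad i x)))\<^sup>2)
      \<le> (\<Sum>i=1..n. 2 * LQ * (1 / real n) * (f i y - f i x - grad i x \<bullet> (y - x)))"
  proof (rule sum_mono)
    fix i assume i: "i \<in> {1..n}"
    have p: "0 < pmf P i" and n: "0 < real n"
      using pmf_P_pos[OF i] n_pos by auto
    have "(norm (grad i y - grad i x))\<^sup>2
        \<le> 2 * (LQ * (real n * pmf P i)) * (f i y - f i x - grad i x \<bullet> (y - x))"
      using p n L_Q_pos i
      by (intro convex_lipschitz_gradient_cocoercive[OF subspace_E assms] f_convex grad_deriv
          grad_in grad_lipschitz) auto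
    then have "1 / ((real n)\<^sup>2 * pmf P i) * (norm (grad i y - grad i x))\<^sup>2
        \<le> 1 / ((real n)\<^sup>2 * pmf P i) * (2 * (LQ * (real n * pmf P i)) * (f i y - f i x - grad i x \<bullet> (y - x)))"
      using p by (intro mult_left_mono) auto
    also have "\<dots> = 2 * LQ * (1 / real n) * (f i y - f i x - grad i x \<bullet> (y - x))"
      using p n by (simp add: power2_eq_square)
    also have "1 / ((real n)\<^sup>2 * pmf P i) * (norm (grad i y - grad i x))\<^sup>2
        = pmf P i * (norm ((1 / (real n * pmf P i)) *\<^sub>R (grad i y - grad i x)))\<^sup>2"
      using p n by (simp add: power_mult_distrib power_divide power2_eq_square)
    finally show "pmf P i * (norm ((1 / (real n * pmf P i)) *\<^sub>R (grad i y - grad i x)))\<^sup>2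
        \<le> 2 * LQ * (1 / real n) * (f i y - f i x - grad i x \<bullet> (y - x))" .
  qed
  also have "\<dots> = 2 * LQ * (favg n f y - favg n f x - gradf x \<bullet> (y - x))"
    by (simp add: favg_def inner_gradf assms sum_subtractf diff_divide_distrib
        right_diff_distrib flip: sum_distrib_left sum_divide_distrib)
  finally show ?thesis .
qed

section \<open>The optimality gap and its lower bounds\<close>

lemma dom_psi_in_E: "x \<in> dom_psi \<Longrightarrow> x \<in> E"
  by (simp add: dom_psi_def)

lemma psi_real: "x \<in> dom_psi \<Longrightarrow> \<psi> x = ereal (real_of_ereal (\<psi> x))"
  using psi by (auto simp: dom_psi_def proper_closed_convex_on_def ereal_real)

lemma xstar_dom: "xstar \<in> dom_psi"
proof -
  obtain y where "y \<in> E" "\<psi> y \<noteq> \<infinity>"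
    using psi by (auto simp: proper_closed_convex_on_def)
  then have "\<psi> xstar + ereal (favg n f xstar) \<noteq> \<infinity>"
    using xstar_minimizer[of y] by (auto simp: objective_def)
  then show ?thesis
    using xstar_in by (auto simp: dom_psi_def)
qed

lemma objective_diff_eq:
  assumes "x \<in> E"
  shows "objective n f \<psi> x - objective n f \<psi> xstar = (if x \<in> dom_psi then ereal (gap x) else \<infinity>)"
proof -
  have star: "objective n f \<psi> xstar = ereal (real_of_ereal (\<psi> xstar) + favg n f xstar)"
    unfolding objective_def by (subst psi_real[OF xstar_dom]) simp
  show ?thesis
  proof (cases "x \<in> dom_psi")
    case True
    have "objective n f \<psi> x = ereal (real_of_ereal (\<psi> x) + favg n f x)"
      unfolding objective_def by (subst psi_real[OF True]) simp
    then show ?thesis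
      using True star by (simp add: gap_def)
  qed (use assms star in \<open>auto simp: objective_def dom_psi_def\<close>)
qed

text \<open>The negative gradient of f at \<open>xstar\<close> is a subgradient of \<psi> there.
  This turns the Bregman distances produced by cocoercivity into gaps.\<close>

lemma gap_ge_bregman:
  assumes "x \<in> dom_psi"
  shows "favg n f x - favg n f xstar - gradf xstar \<bullet> (x - xstar) \<le> gap x"
proof -
  have "real_of_ereal (\<psi> xstar) \<le> real_of_ereal (\<psi> x) + gradf xstar \<bullet> (x - xstar)"
    using xstar_minimizer
    by (intro composite_minimizer_subgradient[OF psi subspace_E xstar_in dom_psi_in_E[OF assms]
        psi_real[OF xstar_dom] psi_real[OF assms] gradf_deriv[OF xstar_in]]) (simp add: objective_def)
  then show ?thesis
    by (simp add: gap_def)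
qed

text \<open>\<open>strongly_convex_on\<close> speaks of subgradients only; at a minimizer 0 is
  one.\<close>

lemma gap_ge_sq_dist:
  assumes x: "x \<in> dom_psi"
  shows "\<mu> / 2 * (norm (x - xstar))\<^sup>2 \<le> gap x"
proof -
  have "0 \<in> subdifferential_on E (objective n f \<psi>) xstar"
    using xstar_minimizer subspace_0[OF subspace_E] by (simp add: subdifferential_on_def zero_ereal_def[symmetric])
  then have "objective n f \<psi> xstar + ereal (0 \<bullet> (x - xstar) + \<mu> / 2 * (norm (x - xstar))\<^sup>2) \<le> objective n f \<psi> x"
    using F_strongly_convex xstar_in dom_psi_in_E[OF x] unfolding strongly_convex_on_def by blast
  moreover have "objective n f \<psi> xstar = ereal (real_of_ereal (\<psi> xstar) + favg n f xstar)"
    unfolding objective_def by (subst psi_real[OF xstar_dom]) simp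
  moreover have "objective n f \<psi> x = ereal (real_of_ereal (\<psi> x) + favg n f x)"
    unfolding objective_def by (subst psi_real[OF x]) simp
  ultimately show ?thesis
    by (simp add: gap_def)
qed

lemma gap_nonneg: "x \<in> dom_psi \<Longrightarrow> 0 \<le> gap x"
  using gap_ge_sq_dist[of x] mu_pos
  by (meson divide_nonneg_nonneg le_numeral_extra(3) mult_nonneg_nonneg order_trans less_imp_le zero_le_numeral zero_le_power2)

lemma sq_dist_le_gap: "x \<in> dom_psi \<Longrightarrow> (norm (x - xstar))\<^sup>2 \<le> 2 / \<mu> * gap x"
  using gap_ge_sq_dist[of x] mu_pos by (simp add: field_simps)

section \<open>A proximal step with a stochastic gradient\<close>

context
  fixes \<eta> :: real
  assumes \<eta>: "0 < \<eta>" "\<eta> * LQ < 1"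
begin

text \<open>The prox objective is bounded below because F has a minimizer and the step size is below
  the inverse smoothness constant, so no affine minorant of the convex part is needed.\<close>

lemma prox_objective_bounded_below:
  assumes w: "w \<in> E"
  obtains c where "\<And>y. y \<in> E \<Longrightarrow>
    ereal c \<le> \<psi> y + ereal (1 / (2 * \<eta>) * (norm (y - w))\<^sup>2 + v \<bullet> y)"
proof -
  \<comment> \<open>The curvature of the prox quadratic that remains after the descent lemma has
    used LQ / 2; the linear term in y - w is absorbed into it.\<close>
  define s where "s = 1 / (2 * \<eta>) - LQ / 2"
  have s: "0 < s"
    using \<eta> by (simp add: s_def field_simps)
  define F0 where "F0 = real_of_ereal (\<psi> xstar) + favg n f xstar"
  define c where "c = F0 - favg n f w + v \<bullet> w - (norm (gradf w - v))\<^sup>2 / (4 * s)"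
  have "ereal c \<le> \<psi> y + ereal (1 / (2 * \<eta>) * (norm (y - w))\<^sup>2 + v \<bullet> y)" if y: "y \<in> E" for y
  proof (cases "y \<in> dom_psi")
    case True
    have "(gradf w - v) \<bullet> (y - w) \<le> s * (norm (y - w))\<^sup>2 + (norm (gradf w - v))\<^sup>2 / (4 * s)"
      by (rule inner_le_weighted_squares[OF s])
    moreover have "F0 \<le> real_of_ereal (\<psi> y) + favg n f y"
      using gap_nonneg[OF True] by (simp add: gap_def F0_def)
    moreover have "favg n f y \<le> favg n f w + gradf w \<bullet> (y - w) + LQ / 2 * (norm (y - w))\<^sup>2"
      by (rule favg_upper[OF w y])
    ultimately have "c \<le> real_of_ereal (\<psi> y) + (1 / (2 * \<eta>) * (norm (y - w))\<^sup>2 + v \<bullet> y)"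
      by (simp add: c_def s_def inner_diff_left inner_diff_right left_diff_distrib)
    then show ?thesis
      by (subst psi_real[OF True]) simp
  qed (use y in \<open>auto simp: dom_psi_def\<close>)
  then show thesis
    using that by blast
qed

lemma prox_step_dom:
  assumes "w \<in> E"
  shows "prox_step E \<psi> \<eta> v w \<in> dom_psi"
proof -
  obtain B where B: "finite B" "span B = E"
    using finite_dim by auto
  obtain c where c: "\<And>y. y \<in> E \<Longrightarrow>
      ereal c \<le> \<psi> y + ereal (1 / (2 * \<eta>) * (norm (y - w))\<^sup>2 + v \<bullet> y)"
    using prox_objective_bounded_below[OF assms] by blast
  show ?thesis
    using prox_step_minimizer(1,2)[OF psi B \<eta>(1) c] by (simp add: dom_psi_def)
qed

lemma prox_step_le:
  fixes v :: 'a
  assumes w: "w \<in> E" and u: "u \<in> dom_psi"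
  defines "x \<equiv> prox_step E \<psi> \<eta> v w"
  shows "real_of_ereal (\<psi> x) \<le> real_of_ereal (\<psi> u) + v \<bullet> (u - x)
      + ((norm (u - w))\<^sup>2 - (norm (x - w))\<^sup>2 - (norm (u - x))\<^sup>2) / (2 * \<eta>)"
proof -
  obtain B where B: "finite B" "span B = E"
    using finite_dim by auto
  obtain c where c: "\<And>y. y \<in> E \<Longrightarrow>
      ereal c \<le> \<psi> y + ereal (1 / (2 * \<eta>) * (norm (y - w))\<^sup>2 + v \<bullet> y)"
    using prox_objective_bounded_below[OF w] by blast
  have x: "x \<in> dom_psi"
    unfolding x_def by (rule prox_step_dom[OF w])
  show ?thesis
    by (rule prox_step_inequality[OF psi subspace_E dom_psi_in_E[OF x] dom_psi_in_E[OF u] \<eta>(1)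
        psi_real[OF x] psi_real[OF u]])
      (use prox_step_minimizer(3)[OF psi B \<eta>(1) c] in \<open>simp add: x_def\<close>)
qed

text \<open>Holds for every \<open>v\<close>. The error term paired with x - xstar is split at
  \<open>w\<close>: the part with w - xstar is linear in \<open>v\<close> and vanishes on average,
  the part with x - w is absorbed by the leftover curvature \<open>s\<close>.\<close>

lemma gap_prox_step_le:
  fixes v :: 'a
  assumes w: "w \<in> E"
  defines "x \<equiv> prox_step E \<psi> \<eta> v w"
  shows "gap x + (norm (x - xstar))\<^sup>2 / (2 * \<eta>) \<le> (norm (w - xstar))\<^sup>2 / (2 * \<eta>)
     + (gradf w - v) \<bullet> (w - xstar) + \<eta> / (2 * (1 - \<eta> * LQ)) * (norm (gradf w - v))\<^sup>2"
proof -
  define s where "s = 1 / (2 * \<eta>) - LQ / 2"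
  have s: "0 < s"
    using \<eta> by (simp add: s_def field_simps)
  have s': "1 / (4 * s) = \<eta> / (2 * (1 - \<eta> * LQ))"
    using \<eta> s by (simp add: s_def field_simps)
  have x: "x \<in> E"
    unfolding x_def by (intro dom_psi_in_E prox_step_dom w)
  have "real_of_ereal (\<psi> x) \<le> real_of_ereal (\<psi> xstar) + v \<bullet> (xstar - x)
      + ((norm (xstar - w))\<^sup>2 - (norm (x - w))\<^sup>2 - (norm (xstar - x))\<^sup>2) / (2 * \<eta>)"
    unfolding x_def by (rule prox_step_le[OF w xstar_dom])
  moreover have "favg n f x \<le> favg n f w + gradf w \<bullet> (x - w) + LQ / 2 * (norm (x - w))\<^sup>2"
    by (rule favg_upper[OF w x])
  moreover have "favg n f w + gradf w \<bullet> (xstar - w) \<le> favg n f xstar"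
    by (rule favg_lower[OF w xstar_in])
  moreover have "(gradf w - v) \<bullet> (x - w)
      \<le> s * (norm (x - w))\<^sup>2 + \<eta> / (2 * (1 - \<eta> * LQ)) * (norm (gradf w - v))\<^sup>2"
    using inner_le_weighted_squares[OF s, of "gradf w - v" "x - w"] s'
    by (metis (no_types, lifting) mult.commute times_divide_eq_right mult.right_neutral)
  ultimately show ?thesis
    by (simp add: gap_def s_def norm_minus_commute diff_divide_distrib inner_diff_left
        inner_diff_right left_diff_distrib)
qed

text \<open>The estimator's noise is a centred version of \<open>X\<close>, and \<open>X\<close> is
  split at \<open>xstar\<close> because only Bregman distances from \<open>xstar\<close> are bounded
  by gaps. The splitting doubles 2 * LQ to 4 * LQ.\<close>

lemma variance_le:
  assumes w0: "w0 \<in> dom_psi" and w: "w \<in> dom_psi"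
  shows "(\<Sum>i=1..n. pmf P i * (norm (gradf w - svrg_gradient E n f P w0 w i))\<^sup>2)
    \<le> 4 * LQ * (gap w + gap w0)"
    and "(\<Sum>i=1..n. pmf P i *\<^sub>R (gradf w - svrg_gradient E n f P w0 w i)) = 0"
proof -
  have E: "w0 \<in> E" "w \<in> E"
    using w0 w by (auto simp: dom_psi_def)
  define Y where "Y = (\<lambda>z i. (1 / (real n * pmf P i)) *\<^sub>R (grad i z - grad i xstar))"
  define X where "X = (\<lambda>i. (1 / (real n * pmf P i)) *\<^sub>R (grad i w - grad i w0))"
  have XY: "X i = Y w i - Y w0 i" for i
    by (simp add: X_def Y_def algebra_simps)
  have diff: "gradf w - svrg_gradient E n f P w0 w i = (gradf w - gradf w0) - X i" for i
    by (simp add: svrg_gradient_def X_def)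
  have "(\<Sum>i=1..n. pmf P i *\<^sub>R X i) = (\<Sum>i=1..n. (1 / real n) *\<^sub>R (grad i w - grad i w0))"
    using pmf_P_pos by (intro sum.cong) (auto simp: X_def order_less_imp_not_eq2)
  also have "\<dots> = gradf w - gradf w0"
    by (simp add: gradf_eq E sum_subtractf scaleR_diff_right flip: scaleR_sum_right)
  finally have mean: "(\<Sum>i=1..n. pmf P i *\<^sub>R X i) = gradf w - gradf w0" .
  show "(\<Sum>i=1..n. pmf P i *\<^sub>R (gradf w - svrg_gradient E n f P w0 w i)) = 0"
    unfolding diff scaleR_diff_right[of _ _ "X _"] sum_subtractf mean
    using sum_P by (simp flip: scaleR_sum_left)
  have Y: "(\<Sum>i=1..n. pmf P i * (norm (Y z i))\<^sup>2) \<le> 2 * LQ * gap z" if z: "z \<in> dom_psi" for z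
  proof -
    have "(\<Sum>i=1..n. pmf P i * (norm (Y z i))\<^sup>2)
        \<le> 2 * LQ * (favg n f z - favg n f xstar - gradf xstar \<bullet> (z - xstar))"
      unfolding Y_def by (rule sum_scaled_grad_diff_le[OF xstar_in dom_psi_in_E[OF z]])
    also have "\<dots> \<le> 2 * LQ * gap z"
      using L_Q_pos by (intro mult_left_mono gap_ge_bregman[OF z]) auto
    finally show ?thesis .
  qed
  have "(\<Sum>i=1..n. pmf P i * (norm (gradf w - svrg_gradient E n f P w0 w i))\<^sup>2)
      \<le> (\<Sum>i=1..n. pmf P i * (norm (X i))\<^sup>2)"
    unfolding diff by (rule sum_weighted_variance_le[OF sum_P mean])
  also have "\<dots> \<le> (\<Sum>i=1..n. pmf P i * (2 * (norm (Y w i))\<^sup>2 + 2 * (norm (Y w0 i))\<^sup>2))"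
    unfolding XY by (intro sum_mono mult_left_mono sq_norm_diff_le) auto
  also have "\<dots> = 2 * (\<Sum>i=1..n. pmf P i * (norm (Y w i))\<^sup>2) + 2 * (\<Sum>i=1..n. pmf P i * (norm (Y w0 i))\<^sup>2)"
    by (simp add: sum_distrib_left sum.distrib algebra_simps)
  also have "\<dots> \<le> 4 * LQ * (gap w + gap w0)"
    using Y[OF w] Y[OF w0] by (simp add: algebra_simps)
  finally show "(\<Sum>i=1..n. pmf P i * (norm (gradf w - svrg_gradient E n f P w0 w i))\<^sup>2)
      \<le> 4 * LQ * (gap w + gap w0)" .
qed

lemma inner_step_expectation_le:
  assumes w0: "w0 \<in> dom_psi" and w: "w \<in> dom_psi"
  defines "x \<equiv> (\<lambda>i. prox_step E \<psi> \<eta> (svrg_gradient E n f P w0 w i) w)"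
  shows "(\<Sum>i=1..n. pmf P i * (gap (x i) + (norm (x i - xstar))\<^sup>2 / (2 * \<eta>)))
    \<le> (norm (w - xstar))\<^sup>2 / (2 * \<eta>) + 2 * (\<eta> * LQ) / (1 - \<eta> * LQ) * (gap w + gap w0)"
proof -
  define \<Delta> where "\<Delta> = (\<lambda>i. gradf w - svrg_gradient E n f P w0 w i)"
  define c where "c = \<eta> / (2 * (1 - \<eta> * LQ))"
  have c: "0 \<le> c"
    using \<eta> by (simp add: c_def)
  have "(\<Sum>i=1..n. pmf P i * (gap (x i) + (norm (x i - xstar))\<^sup>2 / (2 * \<eta>)))
      \<le> (\<Sum>i=1..n. pmf P i * ((norm (w - xstar))\<^sup>2 / (2 * \<eta>) + \<Delta> i \<bullet> (w - xstar) + c * (norm (\<Delta> i))\<^sup>2))"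
    unfolding x_def \<Delta>_def c_def
    by (intro sum_mono mult_left_mono gap_prox_step_le dom_psi_in_E w) auto
  also have "\<dots> = (norm (w - xstar))\<^sup>2 / (2 * \<eta>) + (\<Sum>i=1..n. pmf P i *\<^sub>R \<Delta> i) \<bullet> (w - xstar)
      + c * (\<Sum>i=1..n. pmf P i * (norm (\<Delta> i))\<^sup>2)"
  proof -
    have "(\<Sum>i=1..n. pmf P i * ((norm (w - xstar))\<^sup>2 / (2 * \<eta>)))
        = (\<Sum>i=1..n. pmf P i) * ((norm (w - xstar))\<^sup>2 / (2 * \<eta>))"
      by (rule sum_distrib_right[symmetric])
    then show ?thesis
      unfolding sum_P by (simp add: distrib_left sum.distrib inner_sum_left sum_distrib_left mult.left_commute)
  qed
  also have "\<dots> \<le> (norm (w - xstar))\<^sup>2 / (2 * \<eta>) + c * (4 * LQ * (gap w + gap w0))"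
    unfolding \<Delta>_def variance_le(2)[OF w0 w]
    using mult_left_mono[OF variance_le(1)[OF w0 w] c] by simp
  also have "c * (4 * LQ * (gap w + gap w0)) = 2 * (\<eta> * LQ) / (1 - \<eta> * LQ) * (gap w + gap w0)"
    using \<eta> by (simp add: c_def field_simps)
  finally show ?thesis .
qed

end

end

section \<open>One epoch\<close>

text \<open>The recursion telescopes under the geometric weights. Truncating the sum avoids the question
  whether the full expectation is finite before it has been bounded.\<close>

lemma geometric_average_le:
  fixes a d :: "nat \<Rightarrow> real"
  assumes nonneg: "\<And>t. 0 \<le> a t" "\<And>t. 0 \<le> d t"
    and rec: "\<And>t. a (Suc t) + d (Suc t) \<le> d t + c * (a t + a 0)"
    and p: "0 < p" "p < 1" and c: "0 \<le> c" "c \<le> 22 / 21 * r" and r: "r \<le> 1 / 11"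
    and d0: "p * d 0 \<le> 2 * r * a 0"
  shows "(\<Sum>N<T. p * (1 - p) ^ N * a (N + 2)) \<le> 10 * r * a 0"
proof -
  define q where "q = 1 - p"
  have q: "0 \<le> q" "q \<le> 1"
    using p by (auto simp: q_def)
  \<comment> \<open>An epoch of length N + 1 returns the inner iterate of index N + 2.\<close>
  define A where "A = (\<Sum>N<T. p * q ^ N * a (N + 2))"
  have telescope: "(\<Sum>N<T. q ^ N * (d (N + 1) - d (N + 2))) \<le> d 1 - q ^ T * d (T + 1)"
  proof (induction T)
    case (Suc T)
    have "q * (q ^ T * d (T + 2)) \<le> 1 * (q ^ T * d (T + 2))"
      using q nonneg by (intro mult_right_mono) auto
    with Suc show ?case
      by (simp add: algebra_simps)
  qed simp
  also have "\<dots> \<le> d 1"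
    using q nonneg by simp
  finally have "p * (\<Sum>N<T. q ^ N * (d (N + 1) - d (N + 2))) \<le> p * d 1"
    using p by (intro mult_left_mono) auto
  then have sum_d: "(\<Sum>N<T. p * q ^ N * (d (N + 1) - d (N + 2))) \<le> p * d 1"
    by (simp add: sum_distrib_left mult.assoc)
  \<comment> \<open>Shifting the index costs a factor \<open>q\<close>, which is at most 1, and the
    single term p * a 1; what remains is \<open>A\<close> itself.\<close>
  have sum_a: "(\<Sum>N<T. p * q ^ N * a (N + 1)) \<le> p * a 1 + A"
  proof (cases T)
    case 0
    then show ?thesis
      using p nonneg by (simp add: A_def)
  next
    case (Suc S)
    have "(\<Sum>N<T. p * q ^ N * a (N + 1)) = p * a 1 + (\<Sum>N<S. q * (p * q ^ N * a (N + 2)))"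
      unfolding Suc sum.lessThan_Suc_shift by (simp add: mult_ac)
    also have "(\<Sum>N<S. q * (p * q ^ N * a (N + 2))) \<le> (\<Sum>N<S. 1 * (p * q ^ N * a (N + 2)))"
      using p q nonneg by (intro sum_mono mult_right_mono) auto
    also have "\<dots> \<le> A"
      using p q nonneg by (simp add: A_def Suc)
    finally show ?thesis
      by simp
  qed
  have "(\<Sum>N<T. p * q ^ N) \<le> 1"
  proof -
    have "(\<Sum>N<T. p * q ^ N) = 1 - q ^ T"
      using p by (simp add: q_def sum_gp_strict flip: sum_distrib_left)
    then show ?thesis
      using q by simp
  qed
  then have sum_1: "c * a 0 * (\<Sum>N<T. p * q ^ N) \<le> c * a 0"
    using c nonneg by (intro mult_left_le) auto
  have "A \<le> (\<Sum>N<T. p * q ^ N * ((d (N + 1) - d (N + 2)) + c * (a (N + 1) + a 0)))"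
    unfolding A_def
  proof (rule sum_mono)
    fix N
    have "a (N + 2) \<le> (d (N + 1) - d (N + 2)) + c * (a (N + 1) + a 0)"
      using rec[of "N + 1"] by simp
    then show "p * q ^ N * a (N + 2) \<le> p * q ^ N * ((d (N + 1) - d (N + 2)) + c * (a (N + 1) + a 0))"
      using p q by (intro mult_left_mono) auto
  qed
  also have "\<dots> = (\<Sum>N<T. p * q ^ N * (d (N + 1) - d (N + 2)))
      + c * (\<Sum>N<T. p * q ^ N * a (N + 1)) + c * a 0 * (\<Sum>N<T. p * q ^ N)"
    by (simp add: distrib_left sum.distrib sum_distrib_left mult_ac)
  also have "\<dots> \<le> p * d 1 + c * (p * a 1 + A) + c * a 0"
    by (intro add_mono sum_d sum_1 mult_left_mono[OF sum_a] c)
  finally have A1: "A \<le> p * d 1 + c * (p * a 1 + A) + c * a 0" .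
  \<comment> \<open>The first inner step: the recursion at t = 0 passes from index 1 to index 0,
    where \<open>d0\<close> applies.\<close>
  have "p * d 1 + p * a 1 = p * (a 1 + d 1)"
    by (simp add: algebra_simps)
  also have "\<dots> \<le> p * (d 0 + c * (2 * a 0))"
    using rec[of 0] p by (intro mult_left_mono) auto
  also have "\<dots> = p * d 0 + p * (c * (2 * a 0))"
    by (simp add: algebra_simps)
  also have "\<dots> \<le> 2 * r * a 0 + c * (2 * a 0)"
    using p c nonneg by (intro add_mono d0 mult_left_le_one_le) auto
  finally have ad1: "p * d 1 + p * a 1 \<le> (2 * r + 2 * c) * a 0"
    by (simp add: algebra_simps)
  have "0 \<le> p * d 1" "0 \<le> p * a 1"
    using p nonneg by auto
  then have "p * d 1 \<le> (2 * r + 2 * c) * a 0" "c * (p * a 1) \<le> c * ((2 * r + 2 * c) * a 0)"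
    using ad1 c by (auto intro!: mult_left_mono)
  then have "(1 - c) * A \<le> (2 * r + 3 * c + 2 * (c * r) + 2 * (c * c)) * a 0"
    using A1 by (simp add: algebra_simps)
  also have "\<dots> \<le> ((1 - c) * (10 * r)) * a 0"
  proof (rule mult_right_mono[OF _ nonneg(1)])
    have r0: "0 \<le> r" and c': "c \<le> 2 / 21"
      using c r by auto
    \<comment> \<open>With c \<le> 22/21 * r and c \<le> 2/21 the left side is below 5.6 * r, while
      the right side is at least 190/21 * r.\<close>
    have "c * r \<le> 2 / 21 * r" "c * c \<le> 2 / 21 * c"
      using mult_right_mono[OF c' r0] mult_right_mono[OF c' c(1)] by auto
    then show "2 * r + 3 * c + 2 * (c * r) + 2 * (c * c) \<le> (1 - c) * (10 * r)"
      using c r0 unfolding left_diff_distrib by linarith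
  qed
  finally have "(1 - c) * A \<le> (1 - c) * (10 * r * a 0)"
    by (simp add: mult.assoc)
  then show ?thesis
    using c r by (simp add: A_def q_def)
qed

section \<open>Expectations over the random epoch length\<close>

lemma nn_integral_epoch_length:
  assumes "1 < m"
  shows "(\<integral>\<^sup>+M. h M \<partial>epoch_length m)
    = (\<Sum>N. ennreal ((1 / m) * (1 - 1 / m) ^ N) * h (Suc N))"
proof -
  have "1 / m \<in> {0<..1}"
    using assms by auto
  then show ?thesis
    unfolding epoch_length_def nn_integral_map_pmf
    by (simp add: nn_integral_measure_pmf nn_integral_count_space_nat mult.commute)
qed

lemma nn_integral_epoch_length_id:
  assumes "1 < m"
  shows "(\<integral>\<^sup>+M. ennreal (real M) \<partial>epoch_length m) = ennreal m"
proof -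
  have p: "1 / m \<in> {0<..1}"
    using assms by auto
  have "(\<integral>\<^sup>+M. ennreal (real M) \<partial>epoch_length m)
      = (\<integral>\<^sup>+N. 1 + ennreal (real N) \<partial>geometric_pmf (1 / m))"
    by (simp add: epoch_length_def flip: ennreal_1 ennreal_plus del: ennreal_1)
  also have "\<dots> = 1 + (\<integral>\<^sup>+N. ennreal (real N) \<partial>geometric_pmf (1 / m))"
    by (simp add: nn_integral_add measure_pmf.emeasure_space_1[simplified])
  also have "(\<integral>\<^sup>+N. ennreal (real N) \<partial>geometric_pmf (1 / m)) = ennreal ((1 - 1 / m) / (1 / m))"
    using expectation_geometric_pmf[OF p] integrable_real_geometric_pmf[OF p]
    by (subst nn_integral_eq_integral) auto
  also have "(1 - 1 / m) / (1 / m) = m - 1"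
    using assms by (simp add: field_simps)
  also have "1 + ennreal (m - 1) = ennreal m"
    using assms by (simp flip: ennreal_1 ennreal_plus del: ennreal_1)
  finally show ?thesis .
qed

context prox_finite_sum
begin

abbreviation gap_ennreal :: "'a \<Rightarrow> ennreal" where
  "gap_ennreal x \<equiv> e2ennreal (objective n f \<psi> x - objective n f \<psi> xstar)"

lemma gap_ennreal_dom: "x \<in> dom_psi \<Longrightarrow> gap_ennreal x = ennreal (gap x)"
  by (simp add: objective_diff_eq dom_psi_in_E)

lemma nn_integral_P:
  assumes "\<And>i. i \<in> {1..n} \<Longrightarrow> 0 \<le> h i"
  shows "(\<integral>\<^sup>+i. ennreal (h i) \<partial>P) = ennreal (\<Sum>i=1..n. pmf P i * h i)"
proof -
  have "(\<integral>\<^sup>+i. ennreal (h i) \<partial>P) = (\<Sum>i=1..n. ennreal (h i) * ennreal (pmf P i))"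
    by (subst nn_integral_measure_pmf_finite) (simp_all add: P_support)
  also have "\<dots> = (\<Sum>i=1..n. ennreal (pmf P i * h i))"
    using assms by (intro sum.cong) (auto simp: ennreal_mult' mult.commute)
  also have "\<dots> = ennreal (\<Sum>i=1..n. pmf P i * h i)"
    using assms by (intro sum_ennreal) auto
  finally show ?thesis .
qed

context
  fixes \<eta> :: real
  assumes \<eta>: "0 < \<eta>" "\<eta> * LQ < 1"
begin

lemma set_svrg_inner_dom: "w0 \<in> dom_psi \<Longrightarrow> set_pmf (svrg_inner E n f \<psi> P \<eta> w0 t) \<subseteq> dom_psi"
  by (induction t) (auto intro!: prox_step_dom[OF \<eta>] dom_psi_in_E)

lemma set_svrg_inner_E: "w0 \<in> E \<Longrightarrow> set_pmf (svrg_inner E n f \<psi> P \<eta> w0 t) \<subseteq> E"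
  by (induction t) (auto intro!: dom_psi_in_E[OF prox_step_dom[OF \<eta>]])

text \<open>Conditioning on the iterate of index t reduces this to
  \<open>inner_step_expectation_le\<close>. It is stated in \<open>ennreal\<close> because
  finiteness is itself deduced from it.\<close>

lemma svrg_inner_recursion:
  fixes w0 :: 'a
  assumes w0: "w0 \<in> dom_psi"
  defines "S \<equiv> svrg_inner E n f \<psi> P \<eta> w0"
    and "c \<equiv> 2 * (\<eta> * LQ) / (1 - \<eta> * LQ)"
  shows "(\<integral>\<^sup>+w. ennreal (gap w) \<partial>S (Suc t)) + (\<integral>\<^sup>+w. ennreal ((norm (w - xstar))\<^sup>2 / (2 * \<eta>)) \<partial>S (Suc t))
    \<le> (\<integral>\<^sup>+w. ennreal ((norm (w - xstar))\<^sup>2 / (2 * \<eta>)) \<partial>S t)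
      + ennreal c * ((\<integral>\<^sup>+w. ennreal (gap w) \<partial>S t) + ennreal (gap w0))"
proof -
  define d where "d = (\<lambda>w. (norm (w - xstar))\<^sup>2 / (2 * \<eta>))"
  have d: "0 \<le> d w" for w
    using \<eta> by (simp add: d_def)
  have c: "0 \<le> c"
    using \<eta> L_Q_pos by (simp add: c_def)
  have "(\<integral>\<^sup>+w. ennreal (gap w) \<partial>S (Suc t)) + (\<integral>\<^sup>+w. ennreal (d w) \<partial>S (Suc t))
      = (\<integral>\<^sup>+w. (\<integral>\<^sup>+w'. ennreal (gap w') + ennreal (d w')
          \<partial>map_pmf (\<lambda>i. prox_step E \<psi> \<eta> (svrg_gradient E n f P w0 w i) w) P) \<partial>S t)"
    by (simp add: S_def nn_integral_add flip: nn_integral_add)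
  also have "\<dots> \<le> (\<integral>\<^sup>+w. ennreal (d w) + ennreal c * (ennreal (gap w) + ennreal (gap w0)) \<partial>S t)"
  proof (rule nn_integral_mono_AE, unfold AE_measure_pmf_iff, rule ballI)
    fix w assume "w \<in> set_pmf (S t)"
    then have w: "w \<in> dom_psi"
      using set_svrg_inner_dom[OF w0] by (auto simp: S_def)
    define x where "x = (\<lambda>i. prox_step E \<psi> \<eta> (svrg_gradient E n f P w0 w i) w)"
    have x: "0 \<le> gap (x i)" for i
      unfolding x_def by (intro gap_nonneg prox_step_dom[OF \<eta>] dom_psi_in_E w)
    have "(\<integral>\<^sup>+w'. ennreal (gap w') + ennreal (d w') \<partial>map_pmf x P) = (\<integral>\<^sup>+i. ennreal (gap (x i) + d (x i)) \<partial>P)"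
      using x d by (simp add: ennreal_plus)
    also have "\<dots> = ennreal (\<Sum>i=1..n. pmf P i * (gap (x i) + d (x i)))"
      using x d by (intro nn_integral_P) auto
    also have "\<dots> \<le> ennreal (d w + c * (gap w + gap w0))"
      unfolding d_def c_def x_def by (intro ennreal_leI inner_step_expectation_le[OF \<eta> w0 w])
    also have "\<dots> = ennreal (d w) + ennreal c * (ennreal (gap w) + ennreal (gap w0))"
      using d c gap_nonneg[OF w] gap_nonneg[OF w0] by (simp add: ennreal_plus ennreal_mult)
    finally show "(\<integral>\<^sup>+w'. ennreal (gap w') + ennreal (d w') \<partial>map_pmf x P)
        \<le> ennreal (d w) + ennreal c * (ennreal (gap w) + ennreal (gap w0))" .
  qed
  also have "\<dots> = (\<integral>\<^sup>+w. ennreal (d w) \<partial>S t) + ennreal c * ((\<integral>\<^sup>+w. ennreal (gap w) \<partial>S t) + ennreal (gap w0))"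
    by (simp add: nn_integral_add nn_integral_cmult measure_pmf.emeasure_space_1[simplified])
  finally show ?thesis
    by (simp add: d_def)
qed

text \<open>Multiplying the two equations for \<eta> shows r^2 = kappa / m, so \<open>r\<close> is
  the quantity of the overview.\<close>

lemma epoch_gap_le_dom:
  fixes w0 :: 'a
  assumes w0: "w0 \<in> dom_psi" and m: "1 < m" and r: "r \<le> 1 / 11"
    and \<eta>r: "\<eta> * LQ = r / 2" and \<eta>m: "1 / (\<eta> * \<mu> * m) = 2 * r"
  shows "(\<integral>\<^sup>+M. (\<integral>\<^sup>+w. gap_ennreal w \<partial>svrg_inner E n f \<psi> P \<eta> w0 (M + 1)) \<partial>epoch_length m)
    \<le> ennreal (10 * r) * gap_ennreal w0"
proof -
  define S where "S = svrg_inner E n f \<psi> P \<eta> w0"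
  define c where "c = 2 * (\<eta> * LQ) / (1 - \<eta> * LQ)"
  define dist where "dist = (\<lambda>w. (norm (w - xstar))\<^sup>2 / (2 * \<eta>))"
  define a where "a = (\<lambda>t. \<integral>\<^sup>+w. ennreal (gap w) \<partial>S t)"
  define d where "d = (\<lambda>t. \<integral>\<^sup>+w. ennreal (dist w) \<partial>S t)"
  have r0: "0 < r"
    using mult_pos_pos[OF \<eta>(1) L_Q_pos] \<eta>r by simp
  have c: "0 \<le> c" "c \<le> 22 / 21 * r"
  proof -
    have c_eq: "c = r / (1 - r / 2)"
      by (simp add: c_def \<eta>r)
    show "0 \<le> c"
      unfolding c_eq using r r0 by simp
    \<comment> \<open>This is 1 - r / 2 \<ge> 21/22, the source of the constant 22/21.\<close>
    have "1 \<le> 22 / 21 * (1 - r / 2)"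
      using r by simp
    then have "r * 1 \<le> r * (22 / 21 * (1 - r / 2))"
      using r0 by (intro mult_left_mono) auto
    then show "c \<le> 22 / 21 * r"
      unfolding c_eq using r by (simp add: divide_le_eq mult_ac)
  qed
  have rec: "a (Suc t) + d (Suc t) \<le> d t + ennreal c * (a t + a 0)" for t
    using svrg_inner_recursion[OF w0, of t] by (simp add: a_def d_def dist_def c_def S_def)
  \<comment> \<open>Telescoping subtracts expectations, hence needs real numbers; finiteness
    propagates from the point mass at \<open>w0\<close> along the recursion.\<close>
  have fin: "a t < \<top> \<and> d t < \<top>" for t
  proof (induction t)
    case 0
    show ?case
      by (simp add: a_def d_def S_def)
  next
    case (Suc t)
    then have "a t + a 0 < \<top>"
      by (simp add: a_def S_def)
    then have "d t + ennreal c * (a t + a 0) < \<top>"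
      using Suc by (simp add: ennreal_mult_less_top)
    then have "a (Suc t) + d (Suc t) < \<top>"
      using rec[of t] by (rule order_le_less_trans[rotated])
    then show ?case
      by simp
  qed
  define ra where "ra = (\<lambda>t. enn2real (a t))"
  define rd where "rd = (\<lambda>t. enn2real (d t))"
  have a: "a t = ennreal (ra t)" "0 \<le> ra t" and d: "d t = ennreal (rd t)" "0 \<le> rd t" for t
    using fin[of t] by (auto simp: ra_def rd_def)
  have ra0: "ra 0 = gap w0" and rd0: "rd 0 = dist w0"
    using gap_nonneg[OF w0] \<eta> by (simp_all add: ra_def rd_def a_def d_def S_def dist_def)
  have "ra (Suc t) + rd (Suc t) \<le> rd t + c * (ra t + ra 0)" for t
  proof -
    have "ennreal (ra (Suc t) + rd (Suc t)) \<le> ennreal (rd t + c * (ra t + ra 0))"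
      using rec[of t] a d c by (simp add: ennreal_plus ennreal_mult)
    then show ?thesis
      using a d c by (subst (asm) ennreal_le_iff) auto
  qed
  moreover have "1 / m * rd 0 \<le> 2 * r * ra 0"
  proof -
    have "dist w0 \<le> 2 / \<mu> * gap w0 / (2 * \<eta>)"
      unfolding dist_def using \<eta> by (intro divide_right_mono sq_dist_le_gap w0) auto
    then have "1 / m * dist w0 \<le> 1 / m * (2 / \<mu> * gap w0 / (2 * \<eta>))"
      using m by (intro mult_left_mono) auto
    also have "\<dots> = 1 / (\<eta> * \<mu> * m) * gap w0"
      by simp
    finally show ?thesis
      by (simp only: ra0 rd0 \<eta>m)
  qed
  ultimately have bound: "(\<Sum>N<T. 1 / m * (1 - 1 / m) ^ N * ra (N + 2)) \<le> 10 * r * ra 0" for T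
    using m c r a(2) d(2) by (intro geometric_average_le[where c = c and d = rd]) auto
  have inner: "(\<integral>\<^sup>+w. gap_ennreal w \<partial>S t) = ennreal (ra t)" for t
  proof -
    have "(\<integral>\<^sup>+w. gap_ennreal w \<partial>S t) = a t"
      unfolding a_def using set_svrg_inner_dom[OF w0, of t]
      by (intro nn_integral_cong_AE) (auto simp: AE_measure_pmf_iff S_def gap_ennreal_dom)
    then show ?thesis
      by (simp add: a)
  qed
  have "(\<integral>\<^sup>+M. (\<integral>\<^sup>+w. gap_ennreal w \<partial>S (M + 1)) \<partial>epoch_length m)
      = (\<Sum>N. ennreal (1 / m * (1 - 1 / m) ^ N) * ennreal (ra (N + 2)))"
    by (simp add: nn_integral_epoch_length[OF m] inner)
  also have "\<dots> = (\<Sum>N. ennreal (1 / m * (1 - 1 / m) ^ N * ra (N + 2)))"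
    using m by (intro suminf_cong ennreal_mult'[symmetric] mult_nonneg_nonneg zero_le_power) auto
  also have "\<dots> \<le> ennreal (10 * r * ra 0)"
  proof (rule suminf_le_const)
    fix T
    have "(\<Sum>N<T. ennreal (1 / m * (1 - 1 / m) ^ N * ra (N + 2)))
        = ennreal (\<Sum>N<T. 1 / m * (1 - 1 / m) ^ N * ra (N + 2))"
      using m a(2) by (intro sum_ennreal) auto
    then show "(\<Sum>N<T. ennreal (1 / m * (1 - 1 / m) ^ N * ra (N + 2))) \<le> ennreal (10 * r * ra 0)"
      using bound by (simp add: ennreal_leI)
  qed simp
  also have "\<dots> = ennreal (10 * r) * gap_ennreal w0"
    using r0 gap_nonneg[OF w0] by (simp add: ra0 gap_ennreal_dom[OF w0] ennreal_mult)
  finally show ?thesis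
    by (simp add: S_def)
qed

lemma set_prox_svrg:
  assumes "x0 \<in> E" and "(x, c) \<in> set_pmf (prox_svrg E n f \<psi> P x0 \<eta> m k)"
  shows "x \<in> E"
  using assms(2)
proof (induction k arbitrary: x c)
  case (Suc k)
  then show ?case
    using set_svrg_inner_E by (fastforce simp del: svrg_inner.simps)
qed (use assms in simp)

lemma expected_gap_prox_svrg_le:
  fixes x0 :: 'a
  assumes x0: "x0 \<in> E" and m: "1 < m" and r: "r \<le> 1 / 11"
    and \<eta>r: "\<eta> * LQ = r / 2" and \<eta>m: "1 / (\<eta> * \<mu> * m) = 2 * r"
  shows "expected_gap n f \<psi> xstar (prox_svrg E n f \<psi> P x0 \<eta> m k)
    \<le> ennreal ((10 * r) ^ k) * gap_ennreal x0"
proof (induction k)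
  case 0
  show ?case
    by (simp add: expected_gap_def)
next
  case (Suc k)
  have r0: "0 < r"
    using mult_pos_pos[OF \<eta>(1) L_Q_pos] \<eta>r by simp
  have epoch: "(\<integral>\<^sup>+M. (\<integral>\<^sup>+w. gap_ennreal w \<partial>svrg_inner E n f \<psi> P \<eta> x (M + 1)) \<partial>epoch_length m)
      \<le> ennreal (10 * r) * gap_ennreal x" if "x \<in> E" for x
  proof (cases "x \<in> dom_psi")
    case True
    then show ?thesis
      by (intro epoch_gap_le_dom m r \<eta>r \<eta>m)
  next
    \<comment> \<open>Outside \<open>dom_psi\<close> the gap is infinite, and so is the right side
      because 10 * r is positive.\<close>
    case False
    then show ?thesis
      using that r0 by (simp add: objective_diff_eq ennreal_mult_top)
  qed
  have "expected_gap n f \<psi> xstar (prox_svrg E n f \<psi> P x0 \<eta> m (Suc k))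
      = (\<integral>\<^sup>+(x, c). (\<integral>\<^sup>+M. (\<integral>\<^sup>+w. gap_ennreal w \<partial>svrg_inner E n f \<psi> P \<eta> x (M + 1)) \<partial>epoch_length m)
          \<partial>prox_svrg E n f \<psi> P x0 \<eta> m k)"
    by (simp add: expected_gap_def case_prod_beta' del: svrg_inner.simps)
  also have "\<dots> \<le> (\<integral>\<^sup>+(x, c). ennreal (10 * r) * gap_ennreal x \<partial>prox_svrg E n f \<psi> P x0 \<eta> m k)"
    using set_prox_svrg[OF x0] epoch
    by (intro nn_integral_mono_AE) (auto simp: AE_measure_pmf_iff simp del: svrg_inner.simps)
  also have "\<dots> = ennreal (10 * r) * expected_gap n f \<psi> xstar (prox_svrg E n f \<psi> P x0 \<eta> m k)"
    by (simp add: expected_gap_def case_prod_beta' nn_integral_cmult)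
  also have "\<dots> \<le> ennreal (10 * r) * (ennreal ((10 * r) ^ k) * gap_ennreal x0)"
    by (intro mult_left_mono Suc.IH) auto
  also have "\<dots> = ennreal ((10 * r) ^ Suc k) * gap_ennreal x0"
    using r0 by (simp add: ennreal_mult mult.assoc)
  finally show ?case .
qed

end

section \<open>Expected number of component gradients\<close>

lemma expected_cost_prox_svrg:
  assumes m: "1 < m"
  shows "expected_cost (prox_svrg E n f \<psi> P x0 \<eta> m k) = ennreal (real k * (real n + 2 * (m + 1)))"
proof (induction k)
  case 0
  show ?case
    by (simp add: expected_cost_def)
next
  case (Suc k)
  have epoch: "(\<integral>\<^sup>+M. of_nat (c + n + 2 * (M + 1)) \<partial>epoch_length m)
      = (of_nat c :: ennreal) + ennreal (real n + 2 * (m + 1))" for c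
  proof -
    have "(of_nat (c + n + 2 * (M + 1)) :: ennreal) = ennreal (real (c + n + 2)) + 2 * ennreal (real M)" for M
    proof -
      have "(of_nat (c + n + 2 * (M + 1)) :: ennreal) = of_nat (c + n + 2) + 2 * of_nat M"
        by (simp add: algebra_simps)
      then show ?thesis
        by (simp only: ennreal_of_nat_eq_real_of_nat)
    qed
    then have "(\<integral>\<^sup>+M. of_nat (c + n + 2 * (M + 1)) \<partial>epoch_length m)
        = (\<integral>\<^sup>+M. ennreal (real (c + n + 2)) + 2 * ennreal (real M) \<partial>epoch_length m)"
      by (intro nn_integral_cong) metis
    also have "\<dots> = ennreal (real (c + n + 2)) + 2 * ennreal m"
      by (simp add: nn_integral_add nn_integral_cmult nn_integral_epoch_length_id[OF m]
          measure_pmf.emeasure_space_1[simplified] del: of_nat_add)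
    also have "\<dots> = ennreal (real c + (real n + 2 * (m + 1)))"
      using m by (simp add: ennreal_numeral[symmetric] flip: ennreal_mult ennreal_plus del: ennreal_numeral)
    also have "\<dots> = of_nat c + ennreal (real n + 2 * (m + 1))"
      using m by (simp add: ennreal_plus ennreal_of_nat_eq_real_of_nat)
    finally show ?thesis .
  qed
  have "expected_cost (prox_svrg E n f \<psi> P x0 \<eta> m (Suc k))
      = (\<integral>\<^sup>+(x, c). (\<integral>\<^sup>+M. of_nat (c + n + 2 * (M + 1)) \<partial>epoch_length m) \<partial>prox_svrg E n f \<psi> P x0 \<eta> m k)"
    by (simp add: expected_cost_def case_prod_beta' measure_pmf.emeasure_space_1[simplified]
        del: svrg_inner.simps)
  also have "\<dots> = expected_cost (prox_svrg E n f \<psi> P x0 \<eta> m k) + ennreal (real n + 2 * (m + 1))"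
    unfolding epoch
    by (simp add: expected_cost_def case_prod_beta' nn_integral_add measure_pmf.emeasure_space_1[simplified])
  also have "\<dots> = ennreal (real (Suc k) * (real n + 2 * (m + 1)))"
    using m by (simp add: Suc.IH algebra_simps flip: ennreal_plus)
  finally show ?case .
qed

end

section \<open>Rate and complexity\<close>

lemma one_minus_inverse_le_ln: "0 < x \<Longrightarrow> 1 - inverse x \<le> ln x" for x :: real
  using ln_le_minus_one[of "inverse x"] by (simp add: ln_inverse)

text \<open>For z = n / kappa the argument on the right is the inverse square of
  \<open>rate\<close>. The excess of 121 over 100 keeps the logarithm bounded away from 0 for small
  z; for large z it grows like ln z.\<close>

lemma one_plus_ln_le_ln:
  assumes z: "0 < z"
  shows "(1 + max 0 (ln z)) / 200 \<le> ln (121 / 100 + z / 100 :: real)"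
proof (cases "z \<le> 1")
  case True
  then have "max 0 (ln z) = 0"
    using z by simp
  moreover have "1 / 200 \<le> ln (121 / 100 :: real)"
    using one_minus_inverse_le_ln[of "121 / 100"] by simp
  moreover have "ln (121 / 100) \<le> ln (121 / 100 + z / 100)"
    using z by simp
  ultimately show ?thesis
    by simp
next
  case False
  text \<open>Since the logarithm is concave, a 1/200-fraction of ln z is at most ln (1 + (z - 1) / 200).\<close>
  have "concave_on {0<..} (ln :: real \<Rightarrow> real)"
    by (rule ln_concave)
  then have "(1 - 1 / 200) * ln 1 + 1 / 200 * ln z \<le> ln ((1 - 1 / 200) *\<^sub>R 1 + (1 / 200) *\<^sub>R z)"
    using z by (intro concave_onD) auto
  then have "ln z / 200 \<le> ln (199 / 200 + z / 200)"
    by simp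
  moreover have "ln (1 / 100 + 1) \<ge> (1 / 200 :: real)"
    using one_minus_inverse_le_ln[of "1 / 100 + 1"] by simp
  ultimately have "(1 + ln z) / 200 \<le> ln (199 / 200 + z / 200) + ln (1 / 100 + 1)"
    by (simp add: add_divide_distrib)
  also have "\<dots> = ln ((199 / 200 + z / 200) * (1 / 100 + 1))"
    using z by (intro ln_mult_pos[symmetric]) auto
  also have "\<dots> \<le> ln (121 / 100 + z / 100)"
    using z False by (subst ln_le_cancel_iff) (auto simp: algebra_simps)
  finally show ?thesis
    using False by (simp add: max_def)
qed

context prox_finite_sum
begin

abbreviation kappa :: real where "kappa \<equiv> kappa_Q n L P \<mu>"

abbreviation rate :: real where "rate \<equiv> sqrt (100 / (121 + real n / kappa))"

lemma kappa_pos: "0 < kappa"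
  using L_Q_pos mu_pos by (simp add: kappa_Q_def)

lemma svrg_gap_le_rate:
  fixes x0 :: 'a
  assumes x0: "x0 \<in> E"
  shows "expected_gap n f \<psi> xstar
      (prox_svrg E n f \<psi> P x0 (svrg_eta n kappa LQ) (svrg_m n kappa) k)
    \<le> ennreal (rate ^ k) * gap_ennreal x0"
proof -
  define m where "m = svrg_m n kappa"
  define \<eta> where "\<eta> = svrg_eta n kappa LQ"
  define r where "r = sqrt (kappa / m)"
  have n: "1 \<le> real n"
    using n_pos by simp
  have m: "1 < m"
    using n kappa_pos by (simp add: m_def svrg_m_def)
  have r0: "0 < r"
    using kappa_pos m by (simp add: r_def)
  have r2: "r\<^sup>2 = kappa / m"
    using kappa_pos m by (simp add: r_def)
  have "kappa / m \<le> (1 / 11)\<^sup>2"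
    using n kappa_pos m by (simp add: m_def svrg_m_def power2_eq_square field_simps)
  then have r: "r \<le> 1 / 11"
    unfolding r2[symmetric] by (rule power2_le_imp_le) simp
  have "kappa powr (1 / 2) * m powr (- 1 / 2) = r"
    using kappa_pos m
    by (simp add: r_def real_sqrt_divide powr_half_sqrt powr_minus_divide)
  then have \<eta>_eq: "\<eta> = r / (2 * LQ)"
    by (simp add: \<eta>_def svrg_eta_def m_def)
  have \<eta>: "0 < \<eta>"
    using r0 L_Q_pos by (simp add: \<eta>_eq)
  have \<eta>r: "\<eta> * LQ = r / 2"
    using L_Q_pos by (simp add: \<eta>_eq)
  have "\<eta> * \<mu> * m * (2 * r) = r\<^sup>2 * m / kappa"
    using L_Q_pos mu_pos by (simp add: \<eta>_eq kappa_Q_def power2_eq_square field_simps)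
  also have "\<dots> = 1"
    using m kappa_pos by (simp add: r2)
  finally have \<eta>m: "1 / (\<eta> * \<mu> * m) = 2 * r"
    using \<eta> mu_pos m by (simp add: field_simps)
  have "(121 + real n / kappa) = m / kappa"
    using kappa_pos by (simp add: m_def svrg_m_def field_simps)
  then have "rate = 10 * r"
    by (simp add: r_def real_sqrt_mult real_sqrt_divide)
  then show ?thesis
    using expected_gap_prox_svrg_le[OF \<eta> _ x0 m r \<eta>r \<eta>m, of k] r \<eta>r by (simp add: m_def \<eta>_def)
qed

lemma svrg_cost_eq:
  "expected_cost (prox_svrg E n f \<psi> P x0 \<eta> (svrg_m n kappa) k)
    = ennreal (real k * (real n + 2 * (svrg_m n kappa + 1)))"
  using n_pos kappa_pos by (intro expected_cost_prox_svrg) (simp add: svrg_m_def)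

lemma svrg_complexity:
  fixes x0 :: 'a
  assumes x0: "x0 \<in> E" and gap0: "objective n f \<psi> x0 - objective n f \<psi> xstar = ereal \<Delta>"
    and \<epsilon>: "0 < \<epsilon>" "\<epsilon> < 1" "\<epsilon> * \<Delta> \<le> 1"
  defines "X \<equiv> prox_svrg E n f \<psi> P x0 (svrg_eta n kappa LQ) (svrg_m n kappa)"
  shows "\<exists>k. expected_cost (X k) \<le> ennreal (193600 *
        ((real n / (1 + max 0 (ln (real n / kappa))) + kappa) * ln (1 / \<epsilon>) + real n + kappa)) \<and>
      expected_gap n f \<psi> xstar (X k) < ennreal \<epsilon>"
proof -
  define z where "z = real n / kappa"
  define l where "l = 1 + max 0 (ln z)"
  have n: "1 \<le> real n"
    using n_pos by simp
  have z: "0 < z"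
    using n kappa_pos by (simp add: z_def)
  have l: "1 \<le> l"
    by (simp add: l_def)
  have ln\<epsilon>: "0 \<le> ln (1 / \<epsilon>)"
    using \<epsilon> by simp
  define \<rho> where "\<rho> = rate"
  have \<rho>: "0 < \<rho>"
    using z by (simp add: \<rho>_def z_def)
  have "\<rho> = sqrt (inverse (121 / 100 + z / 100))"
    using z by (simp add: \<rho>_def z_def field_simps)
  then have "ln \<rho> = - (ln (121 / 100 + z / 100) / 2)"
    using z by (simp add: ln_sqrt ln_inverse del: inverse_eq_divide)
  with one_plus_ln_le_ln[OF z] have \<rho>_l: "l / 400 \<le> - ln \<rho>"
    by (simp add: l_def)
  \<comment> \<open>Here 800 = 2 * 400: more than \<open>q\<close> epochs push \<rho>^k below
    \<epsilon>^2. One factor \<epsilon> pays for \<Delta>, since \<epsilon> * \<Delta> \<le> 1.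
    Rounding down and adding 1 makes k strictly larger than \<open>q\<close>.\<close>
  define q where "q = 800 * ln (1 / \<epsilon>) / l"
  define k where "k = nat \<lfloor>q\<rfloor> + 1"
  have q: "0 \<le> q"
    using ln\<epsilon> l by (simp add: q_def)
  have k: "q < real k" "real k \<le> q + 1"
    using q by (auto simp: k_def) linarith+
  have "expected_gap n f \<psi> xstar (X k) \<le> ennreal (\<rho> ^ k) * ennreal \<Delta>"
    using svrg_gap_le_rate[OF x0, of k] gap0 by (simp add: X_def \<rho>_def)
  also have "\<dots> < ennreal \<epsilon>"
  proof (cases "0 < \<Delta>")
    case True
    have "ln \<Delta> \<le> ln (1 / \<epsilon>)"
      using True \<epsilon> by (subst ln_le_cancel_iff) (auto simp: field_simps)
    moreover have "real k * ln \<rho> < - (2 * ln (1 / \<epsilon>))"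
    proof -
      have "2 * ln (1 / \<epsilon>) = q * (l / 400)"
        using l by (simp add: q_def)
      also have "\<dots> < real k * (l / 400)"
        using k l by (intro mult_strict_right_mono) auto
      also have "\<dots> \<le> real k * (- ln \<rho>)"
        by (intro mult_left_mono \<rho>_l) auto
      finally show ?thesis
        by simp
    qed
    ultimately have "ln (\<rho> ^ k * \<Delta>) < ln \<epsilon>"
      using True \<rho> \<epsilon> by (simp add: ln_mult ln_realpow ln_div)
    then have "\<rho> ^ k * \<Delta> < \<epsilon>"
      using True \<rho> \<epsilon> by (subst (asm) ln_less_cancel_iff) auto
    then show ?thesis
      using True \<rho> \<epsilon> by (simp add: ennreal_mult[symmetric] ennreal_lessI)
  next
    case False
    then show ?thesis
      using \<epsilon> by (simp add: ennreal_neg)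
  qed
  finally have gap: "expected_gap n f \<psi> xstar (X k) < ennreal \<epsilon>" .
  \<comment> \<open>An epoch costs 3 * n + 242 * kappa + 2, at most 242 * (n + kappa) as n \<ge> 1;
    and 193600 = 800 * 242.\<close>
  have "real k * (real n + 2 * (svrg_m n kappa + 1)) \<le> (q + 1) * (242 * (real n + kappa))"
    using n kappa_pos k q by (intro mult_mono) (auto simp: svrg_m_def)
  also have "\<dots> = 193600 * (real n / l + kappa / l) * ln (1 / \<epsilon>) + 242 * (real n + kappa)"
    by (simp add: q_def algebra_simps add_divide_distrib)
  also have "\<dots> \<le> 193600 * (real n / l + kappa) * ln (1 / \<epsilon>) + 193600 * (real n + kappa)"
  proof -
    have "kappa / l \<le> kappa"
      using l kappa_pos by (simp add: divide_le_eq)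
    then show ?thesis
      using n kappa_pos ln\<epsilon> by (intro add_mono mult_right_mono) auto
  qed
  also have "\<dots> = 193600 * ((real n / l + kappa) * ln (1 / \<epsilon>) + real n + kappa)"
    by (simp add: algebra_simps)
  finally have "expected_cost (X k) \<le> ennreal (193600 * ((real n / l + kappa) * ln (1 / \<epsilon>) + real n + kappa))"
    unfolding X_def svrg_cost_eq by (rule ennreal_leI)
  then show ?thesis
    using gap unfolding l_def z_def by blast
qed

end

theorem corollary2:
  shows
    "(\<forall>(E :: 'a::real_inner set) n f \<psi> L Lf \<mu> xstar P x0.
        prox_finite_sum E n f \<psi> L Lf \<mu> xstar P \<and> x0 \<in> E \<longrightarrow>
        (let \<kappa> = kappa_Q n L P \<mu>;
             m = svrg_m n \<kappa>;
             \<eta> = svrg_eta n \<kappa> (L_Q n L P)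
         in \<exists>\<rho>. 0 \<le> \<rho> \<and> \<rho> \<le> sqrt (100 / (121 + real n / \<kappa>)) \<and>
              (\<forall>k. expected_gap n f \<psi> xstar (prox_svrg E n f \<psi> P x0 \<eta> m k)
                   \<le> ennreal (\<rho> ^ k) * e2ennreal (objective n f \<psi> x0 - objective n f \<psi> xstar))))
   \<and> (\<forall>\<Delta>::real. \<exists>C>0. \<exists>\<epsilon>0>0.
        \<forall>(E :: 'a set) n f \<psi> L Lf \<mu> xstar P x0.
        prox_finite_sum E n f \<psi> L Lf \<mu> xstar P \<and> x0 \<in> E \<and>
        objective n f \<psi> x0 - objective n f \<psi> xstar = ereal \<Delta> \<longrightarrow>
        (let \<kappa> = kappa_Q n L P \<mu>;
             m = svrg_m n \<kappa>;
             \<eta> = svrg_eta n \<kappa> (L_Q n L P)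
         in \<forall>\<epsilon>. 0 < \<epsilon> \<and> \<epsilon> < \<epsilon>0 \<longrightarrow>
              (\<exists>k. expected_cost (prox_svrg E n f \<psi> P x0 \<eta> m k)
                     \<le> ennreal (C * ((real n / (1 + max 0 (ln (real n / \<kappa>))) + \<kappa>) * ln (1 / \<epsilon>)
                                     + real n + \<kappa>)) \<and>
                   expected_gap n f \<psi> xstar (prox_svrg E n f \<psi> P x0 \<eta> m k) < ennreal \<epsilon>)))"
proof (intro conjI allI, goal_cases)
  case (1 E n f \<psi> L Lf \<mu> xstar P x0)
  show ?case
    unfolding Let_def
  proof (intro impI exI conjI allI; (elim conjE)?)
    assume "prox_finite_sum E n f \<psi> L Lf \<mu> xstar P" and x0: "x0 \<in> E"
    then interpret prox_finite_sum E n f \<psi> L Lf \<mu> xstar P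
      by simp
    show "0 \<le> rate"
      using kappa_pos by simp
    show "rate \<le> rate"
      by simp
    show "expected_gap n f \<psi> xstar
        (prox_svrg E n f \<psi> P x0 (svrg_eta n kappa LQ) (svrg_m n kappa) k)
      \<le> ennreal (rate ^ k) * gap_ennreal x0" for k
      by (rule svrg_gap_le_rate[OF x0])
  qed
next
  case (2 \<Delta>)
  \<comment> \<open>This threshold forces both \<epsilon> < 1 and \<epsilon> * \<Delta> \<le> 1. The
    initial gap enters here alone; the constant 193600 is absolute.\<close>
  define \<epsilon>0 where "\<epsilon>0 = 1 / (1 + \<bar>\<Delta>\<bar>)"
  have \<epsilon>0: "\<epsilon> < 1 \<and> \<epsilon> * \<Delta> \<le> 1" if "0 < \<epsilon>" "\<epsilon> < \<epsilon>0" for \<epsilon>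
  proof -
    have "\<epsilon> + \<epsilon> * \<bar>\<Delta>\<bar> < 1"
      using that by (auto simp: \<epsilon>0_def less_divide_eq algebra_simps split: if_splits)
    moreover have "\<epsilon> * \<Delta> \<le> \<epsilon> * \<bar>\<Delta>\<bar>" "0 \<le> \<epsilon> * \<bar>\<Delta>\<bar>"
      using that by (auto intro: mult_left_mono)
    ultimately show ?thesis
      using that by linarith
  qed
  show ?case
    unfolding Let_def
  proof (rule exI[of _ 193600], rule conjI[rotated], rule exI[of _ \<epsilon>0], intro conjI allI impI)
    fix E :: "'a set" and n f \<psi> L Lf \<mu> xstar P x0 \<epsilon>
    assume "prox_finite_sum E n f \<psi> L Lf \<mu> xstar P \<and> x0 \<in> E \<and>
        objective n f \<psi> x0 - objective n f \<psi> xstar = ereal \<Delta>" and "0 < \<epsilon> \<and> \<epsilon> < \<epsilon>0"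
    then show "\<exists>k. expected_cost (prox_svrg E n f \<psi> P x0
          (svrg_eta n (kappa_Q n L P \<mu>) (L_Q n L P)) (svrg_m n (kappa_Q n L P \<mu>)) k)
        \<le> ennreal (193600 * ((real n / (1 + max 0 (ln (real n / kappa_Q n L P \<mu>)))
            + kappa_Q n L P \<mu>) * ln (1 / \<epsilon>) + real n + kappa_Q n L P \<mu>)) \<and>
      expected_gap n f \<psi> xstar (prox_svrg E n f \<psi> P x0
          (svrg_eta n (kappa_Q n L P \<mu>) (L_Q n L P)) (svrg_m n (kappa_Q n L P \<mu>)) k) < ennreal \<epsilon>"
      using prox_finite_sum.svrg_complexity \<epsilon>0 by blast
  qed (auto simp: \<epsilon>0_def)
qed

end
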